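(* For each prime power $q\ge 2^{40}$ there exists a $K_4$-free graph $G_q^*$ with $q^2(q^2-q+1)$ vertices such that for every set $X$ of at least $m=2^{24}q^2$ vertices of $G_q^*$, \[ e(G_q^*[X])\;\ge\;\frac{|X|^2}{256q}. \]
   Context: $e(G[X])$ denotes the number of edges of the subgraph of $G$ induced by $X$. *)

theory Defs
  imports Complex_Main "HOL-Computational_Algebra.Primes"
begin

definition simple_graph :: "'a set \<Rightarrow> 'a set set \<Rightarrow> bool" where
  "simple_graph V E \<longleftrightarrow> finite V \<and> (\<forall>e\<in>E. e \<subseteq> V \<and> card e = 2)"

definition K4_free :: "'a set \<Rightarrow> 'a set set \<Rightarrow> bool" where
  "K4_free V E \<longleftrightarrow> \<not> (\<exists>a\<in>V. \<exists>b\<in>V. \<exists>c\<in>V. \<exists>d\<in>V.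
      distinct [a,b,c,d] \<and>
      {a,b} \<in> E \<and> {a,c} \<in> E \<and> {a,d} \<in> E \<and>
      {b,c} \<in> E \<and> {b,d} \<in> E \<and> {c,d} \<in> E)"

definition induced_edges :: "'a set set \<Rightarrow> 'a set \<Rightarrow> nat" where
  "induced_edges E X = card {e\<in>E. e \<subseteq> X}"

definition prime_power :: "nat \<Rightarrow> bool" where
  "prime_power q \<longleftrightarrow> (\<exists>p k. prime p \<and> k \<ge> 1 \<and> q = p ^ k)"

end

theory Submission
  imports Defs "HOL-Computational_Algebra.Polynomial" "HOL-Library.FuncSet"
begin

text \<open>
  The affine points of the Hermitian unital \<open>y^q + y = x^(q+1)\<close> over the field with \<open>q\<^sup>2\<close> elements,
  together with the \<open>q^4 - q^3\<close> lines \<open>y = a x + b\<close> that are not tangent to it, contain no O'Nan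
  configuration. Joining two lines that meet on the unital gives \<open>q^3\<close> edge-disjoint cliques, and
  replacing each clique by a complete bipartite graph on a random bipartition destroys every
  \<open>K\<^sub>4\<close>. For a set \<open>X\<close> of lines, the points of the unital see about \<open>q |X|\<close> incidences with \<open>X\<close>; a
  point on \<open>x\<close> lines of \<open>X\<close> receives an unbalanced bipartition with probability exponentially small
  in \<open>x\<close>, so that a union bound over the points and over all \<open>X\<close> leaves at least half of the
  incidences at balanced points, and convexity gives the edge count. The \<open>q\<^sup>2\<close> lines through the
  point at infinity are not needed: isolated vertices take their place, since
  \<open>|X| \<ge> 2^24 q\<^sup>2\<close> makes them negligible.

  Since a type cannot depend on \<open>q\<close>, the finite field is a quotient of \<open>int poly\<close> by a prime ideal,
  handled through congruences: the ideal extends the one of all polynomials whose value at a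
  primitive complex root of unity of order \<open>q\<^sup>2 - 1\<close> is divisible by \<open>p\<close>, so that the powers of the
  indeterminate represent the nonzero field elements.
\<close>

section \<open>Prime ideals\<close>

locale ring_ideal =
  fixes I :: "'r::comm_ring_1 set"
  assumes zero_mem: "0 \<in> I"
    and add_mem: "a \<in> I \<Longrightarrow> b \<in> I \<Longrightarrow> a + b \<in> I"
    and mult_mem: "a \<in> I \<Longrightarrow> r * a \<in> I"
begin

definition cg (infix "\<approx>" 50) where "a \<approx> b \<longleftrightarrow> a - b \<in> I"

lemma mult_mem': "a \<in> I \<Longrightarrow> a * r \<in> I"
  using mult_mem[of a r] by (simp add: mult.commute)

lemma minus_mem: "a \<in> I \<Longrightarrow> - a \<in> I"
  using mult_mem[of a "-1"] by simp

lemma diff_mem: "a \<in> I \<Longrightarrow> b \<in> I \<Longrightarrow> a - b \<in> I"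
  using add_mem[OF _ minus_mem, of a b] by simp

lemma sum_mem: "(\<And>x. x \<in> A \<Longrightarrow> f x \<in> I) \<Longrightarrow> sum f A \<in> I"
  by (induction A rule: infinite_finite_induct) (auto simp: zero_mem add_mem)

lemma prod_mem: "finite A \<Longrightarrow> x \<in> A \<Longrightarrow> f x \<in> I \<Longrightarrow> prod f A \<in> I"
  by (simp add: prod.remove mult_mem')

lemma cg_zero_iff [simp]: "a \<approx> 0 \<longleftrightarrow> a \<in> I"
  by (simp add: cg_def)

lemma cg_refl [simp]: "a \<approx> a"
  by (simp add: cg_def zero_mem)

lemma cg_sym: "a \<approx> b \<Longrightarrow> b \<approx> a"
  using minus_mem[of "a - b"] by (simp add: cg_def)

lemma cg_trans [trans]: "a \<approx> b \<Longrightarrow> b \<approx> c \<Longrightarrow> a \<approx> c"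
  using add_mem[of "a - b" "b - c"] by (simp add: cg_def)

lemma cg_add: "a \<approx> b \<Longrightarrow> c \<approx> d \<Longrightarrow> a + c \<approx> b + d"
  using add_mem[of "a - b" "c - d"] by (simp add: cg_def algebra_simps)

lemma cg_minus: "a \<approx> b \<Longrightarrow> - a \<approx> - b"
  using minus_mem[of "a - b"] by (simp add: cg_def)

lemma cg_diff: "a \<approx> b \<Longrightarrow> c \<approx> d \<Longrightarrow> a - c \<approx> b - d"
  using cg_add[OF _ cg_minus, of a b c d] by simp

lemma cg_mult: "a \<approx> b \<Longrightarrow> c \<approx> d \<Longrightarrow> a * c \<approx> b * d"
proof -
  assume "a \<approx> b" "c \<approx> d"
  then have "(a - b) * c + b * (c - d) \<in> I"
    unfolding cg_def by (intro add_mem mult_mem mult_mem')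
  then show ?thesis by (simp add: cg_def algebra_simps)
qed

lemma cg_power: "a \<approx> b \<Longrightarrow> a ^ i \<approx> b ^ i"
  by (induction i) (auto intro: cg_mult)

text \<open>The inner binomial coefficients are multiples of \<open>p\<close>, so their terms lie in
  \<open>I\<close> and only the two pure powers survive.\<close>

lemma frobenius_prime:
  assumes "prime p" "of_nat p \<in> I"
  shows "(a + b) ^ p \<approx> a ^ p + b ^ p"
proof -
  let ?t = "\<lambda>k. of_nat (p choose k) * a ^ k * b ^ (p - k)"
  have p: "p \<ge> 1" using prime_ge_1_nat[OF assms(1)] .
  have "(a + b) ^ p = (\<Sum>k\<le>p. ?t k)"
    by (simp add: binomial_ring)
  also have "{..p} = insert 0 (insert p {0<..<p})"
    using p by auto
  also have "(\<Sum>k\<in>\<dots>. ?t k) = b ^ p + (a ^ p + (\<Sum>k\<in>{0<..<p}. ?t k))"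
    using p by simp
  finally have eq: "(a + b) ^ p - (a ^ p + b ^ p) = (\<Sum>k\<in>{0<..<p}. ?t k)"
    by simp
  have "?t k \<in> I" if "k \<in> {0<..<p}" for k
  proof -
    have "p dvd (p choose k)"
      using that assms(1) by (intro dvd_choose_prime) auto
    then obtain c where "p choose k = p * c" by (elim dvdE)
    then show ?thesis
      using assms(2) by (auto intro!: mult_mem')
  qed
  then show ?thesis
    unfolding cg_def eq by (intro sum_mem)
qed

lemma frobenius:
  assumes "prime p" "of_nat p \<in> I"
  shows "(a + b) ^ (p ^ k) \<approx> a ^ (p ^ k) + b ^ (p ^ k)"
proof (induction k)
  case (Suc k)
  have "((a + b) ^ (p ^ k)) ^ p \<approx> (a ^ (p ^ k) + b ^ (p ^ k)) ^ p"
    by (rule cg_power[OF Suc])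
  also have "\<dots> \<approx> (a ^ (p ^ k)) ^ p + (b ^ (p ^ k)) ^ p"
    by (rule frobenius_prime[OF assms])
  finally show ?case
    by (simp add: power_mult[symmetric] mult.commute)
qed simp

text \<open>Additivity applied to \<open>a + (- a) = 0\<close> yields the sign without separating
  even and odd \<open>p\<close>.\<close>

lemma frobenius_minus:
  assumes "prime p" "of_nat p \<in> I"
  shows "(- a) ^ (p ^ k) \<approx> - (a ^ (p ^ k))"
proof -
  have "p ^ k > 0" using prime_gt_0_nat[OF assms(1)] by simp
  then have "0 \<approx> a ^ (p ^ k) + (- a) ^ (p ^ k)"
    using frobenius[OF assms, of a "- a" k] by (simp add: zero_power)
  then show ?thesis
    using minus_mem by (force simp: cg_def)
qed

text \<open>Fermat's little theorem, by adding 1 repeatedly under the Frobenius map. It serves for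
  the integer coefficients when that map is applied to a polynomial.\<close>

lemma fermat_of_int:
  assumes "prime p" "of_nat p \<in> I"
  shows "of_int z ^ (p ^ k) \<approx> of_int z"
proof -
  have pos: "p ^ k > 0" using prime_gt_0_nat[OF assms(1)] by simp
  have nat: "of_nat m ^ (p ^ k) \<approx> of_nat m" for m
  proof (induction m)
    case (Suc m)
    have "(1 + of_nat m) ^ (p ^ k) \<approx> 1 ^ (p ^ k) + of_nat m ^ (p ^ k)"
      by (rule frobenius[OF assms])
    also have "\<dots> \<approx> 1 + of_nat m"
      using Suc by (intro cg_add) auto
    finally show ?case by simp
  qed (use pos in \<open>simp add: zero_power\<close>)
  show ?thesis
  proof (cases z rule: int_cases2)
    case (nonneg m)
    then show ?thesis using nat[of m] by simp
  next
    case (nonpos m)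
    then show ?thesis
      using cg_trans[OF frobenius_minus[OF assms] cg_minus[OF nat[of m]]] by simp
  qed
qed

end

locale prime_ideal = ring_ideal I for I :: "'r::comm_ring_1 set" +
  assumes prime_mem: "a * b \<in> I \<Longrightarrow> a \<in> I \<or> b \<in> I"
    and one_notin: "1 \<notin> I"
begin

lemma mult_notin: "a \<notin> I \<Longrightarrow> b \<notin> I \<Longrightarrow> a * b \<notin> I"
  using prime_mem by blast

lemma power_mem: "a ^ i \<in> I \<Longrightarrow> a \<in> I"
  by (induction i) (use one_notin prime_mem in auto)

lemma prod_memD: "finite A \<Longrightarrow> prod f A \<in> I \<Longrightarrow> \<exists>x\<in>A. f x \<in> I"
  by (induction A rule: finite_induct) (use one_notin prime_mem in auto)

end

text \<open>Zorn's lemma yields a maximal proper ideal \<open>M\<close>. It is prime: if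
  \<open>a\<close> is outside \<open>M\<close>, then \<open>1 = m + r * a\<close> with
  \<open>m\<close> in \<open>M\<close>, and multiplying by \<open>b\<close> puts \<open>b\<close>
  into \<open>M\<close> whenever \<open>a * b\<close> is there.\<close>

lemma proper_ideal_extends_to_prime:
  assumes "ring_ideal J" "1 \<notin> J"
  obtains I where "prime_ideal I" "J \<subseteq> I"
proof -
  define A where "A = {K. ring_ideal K \<and> 1 \<notin> K \<and> J \<subseteq> K}"
  have "\<exists>M\<in>A. \<forall>X\<in>A. M \<subseteq> X \<longrightarrow> X = M"
  proof (rule subset_Zorn_nonempty)
    show "A \<noteq> {}" using assms by (auto simp: A_def)
    fix C assume C: "C \<noteq> {}" "subset.chain A C"
    have CA: "C \<subseteq> A" and lin: "\<And>X Y. X \<in> C \<Longrightarrow> Y \<in> C \<Longrightarrow> X \<subseteq> Y \<or> Y \<subseteq> X"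
      using C(2) by (auto simp: subset_chain_def)
    have id: "ring_ideal X" if "X \<in> C" for X
      using that CA by (auto simp: A_def)
    have "ring_ideal (\<Union>C)"
    proof
      show "0 \<in> \<Union>C" using C(1) id ring_ideal.zero_mem by blast
      show "a + b \<in> \<Union>C" if "a \<in> \<Union>C" "b \<in> \<Union>C" for a b
      proof -
        from that obtain X Y where "X \<in> C" "Y \<in> C" "a \<in> X" "b \<in> Y" by auto
        then show ?thesis
          using lin[of X Y] ring_ideal.add_mem[OF id] by blast
      qed
      show "r * a \<in> \<Union>C" if "a \<in> \<Union>C" for r a
        using that ring_ideal.mult_mem[OF id] by blast
    qed
    then show "\<Union>C \<in> A" using CA C(1) by (auto simp: A_def)
  qed
  then obtain M where M: "M \<in> A" and max: "\<And>X. X \<in> A \<Longrightarrow> M \<subseteq> X \<Longrightarrow> X = M" by blast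
  interpret M: ring_ideal M using M by (simp add: A_def)
  have "a \<in> M \<or> b \<in> M" if ab: "a * b \<in> M" for a b
  proof (rule ccontr)
    assume neg: "\<not> (a \<in> M \<or> b \<in> M)"
    define N where "N = {m + r * a |m r. m \<in> M}"
    have "ring_ideal N"
    proof
      show "0 \<in> N" unfolding N_def using M.zero_mem by (force intro: exI[of _ 0])
      show "x + y \<in> N" if "x \<in> N" "y \<in> N" for x y
      proof -
        from that obtain m r m' r' where *: "x = m + r * a" "y = m' + r' * a" "m \<in> M" "m' \<in> M"
          by (auto simp: N_def)
        then have "x + y = (m + m') + (r + r') * a" by (simp add: algebra_simps)
        then show ?thesis using M.add_mem * unfolding N_def by blast
      qed
      show "s * x \<in> N" if "x \<in> N" for s x
      proof -
        from that obtain m r where *: "x = m + r * a" "m \<in> M"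
          by (auto simp: N_def)
        then have "s * x = s * m + (s * r) * a" by (simp add: algebra_simps)
        then show ?thesis using M.mult_mem * unfolding N_def by blast
      qed
    qed
    moreover have MN: "M \<subseteq> N" unfolding N_def by (force intro: exI[of _ 0])
    moreover have "a \<in> N" unfolding N_def using M.zero_mem by (force intro: exI[of _ 0] exI[of _ 1])
    ultimately have "1 \<in> N"
      using max[of N] neg M by (auto simp: A_def)
    then obtain m r where mr: "1 = m + r * a" "m \<in> M" by (auto simp: N_def)
    have "b = b * m + r * (a * b)" using mr(1)
      by (metis (no_types, lifting) distrib_left mult.assoc mult.commute mult.right_neutral)
    then have "b \<in> M" using M.add_mem M.mult_mem mr ab by metis
    then show False using neg by simp
  qed
  then have "prime_ideal M"
    using M by unfold_locales (auto simp: A_def)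
  then show ?thesis using that M by (auto simp: A_def)
qed

section \<open>Finite fields as residue rings of integer polynomials\<close>

text \<open>The set \<open>{1}\<close> is independent over the rationals, so the value 1 there
  extends linearly to all complex numbers. Such a functional allows denominators to be controlled in
  the ring generated by a root of unity.\<close>

lemma rational_functional_exists:
  obtains \<phi> :: "complex \<Rightarrow> rat" where "\<And>x y. \<phi> (x + y) = \<phi> x + \<phi> y"
    "\<And>r x. \<phi> (of_rat r * x) = r * \<phi> x" "\<phi> 1 = 1"
proof -
  interpret V: vector_space "\<lambda>(r::rat) (z::complex). of_rat r * z"
    by unfold_locales (simp_all add: algebra_simps of_rat_add of_rat_mult)
  interpret W: vector_space "(*) :: rat \<Rightarrow> rat \<Rightarrow> rat"
    by unfold_locales (simp_all add: algebra_simps)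
  interpret VW: vector_space_pair "\<lambda>(r::rat) (z::complex). of_rat r * z" "(*) :: rat \<Rightarrow> rat \<Rightarrow> rat" ..
  have "V.independent {1}" by (simp add: V.dependent_single)
  from VW.linear_independent_extend[OF this, of "\<lambda>_. 1"]
  obtain g where g: "Vector_Spaces.linear (\<lambda>(r::rat) (z::complex). of_rat r * z) (*) g" "g 1 = 1"
    by auto
  interpret g: Vector_Spaces.linear "\<lambda>(r::rat) (z::complex). of_rat r * z" "(*) :: rat \<Rightarrow> rat \<Rightarrow> rat" g
    by (rule g(1))
  show ?thesis by (rule that[of g]) (use g g.add g.scale in auto)
qed

definition eval_at :: "complex \<Rightarrow> int poly \<Rightarrow> complex" where
  "eval_at z f = poly (map_poly of_int f) z"

lemma eval_at_pCons [simp]: "eval_at z (pCons a f) = of_int a + z * eval_at z f"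
  by (simp add: eval_at_def map_poly_pCons)

lemma eval_at_0 [simp]: "eval_at z 0 = 0"
  by (simp add: eval_at_def)

lemma eval_at_1 [simp]: "eval_at z 1 = 1"
  by (simp add: one_pCons)

lemma eval_at_add [simp]: "eval_at z (f + g) = eval_at z f + eval_at z g"
  by (induction f g rule: poly_induct2) (simp_all add: algebra_simps)

lemma eval_at_smult [simp]: "eval_at z (smult a f) = of_int a * eval_at z f"
  by (induction f) (simp_all add: algebra_simps)

lemma eval_at_mult [simp]: "eval_at z (f * g) = eval_at z f * eval_at z g"
  by (induction f) (simp_all add: algebra_simps)

lemma eval_at_minus [simp]: "eval_at z (- f) = - eval_at z f"
  using eval_at_smult[of z "-1" f] by simp

lemma eval_at_diff [simp]: "eval_at z (f - g) = eval_at z f - eval_at z g"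
  using eval_at_add[of z f "- g"] by simp

lemma eval_at_power [simp]: "eval_at z (f ^ i) = eval_at z f ^ i"
  by (induction i) simp_all

lemma eval_at_prod [simp]: "eval_at z (prod f A) = (\<Prod>x\<in>A. eval_at z (f x))"
  by (induction A rule: infinite_finite_induct) simp_all

lemma eval_at_of_nat [simp]: "eval_at z (of_nat m) = of_nat m"
  by (simp add: of_nat_poly)

text \<open>Powers of \<open>z\<close> repeat with period \<open>n\<close>, so one integer
  \<open>D\<close> clears the denominators of the functional on all values of integer polynomials at
  \<open>z\<close>. If \<open>1 / p\<close> were such a value, so would be all its powers, and
  \<open>D\<close> would be divisible by every power of \<open>p\<close>.\<close>

lemma inverse_integer_notin_cyclotomic_ring:
  assumes "z ^ n = 1" "n > 0" "p > 1"
  shows "of_nat p * eval_at z f \<noteq> 1"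
proof
  assume eq: "of_nat p * eval_at z f = 1"
  obtain \<phi> :: "complex \<Rightarrow> rat" where add: "\<And>x y. \<phi> (x + y) = \<phi> x + \<phi> y"
    and scale: "\<And>r x. \<phi> (of_rat r * x) = r * \<phi> x" and one: "\<phi> 1 = 1"
    using rational_functional_exists by blast
  define D where "D = (\<Prod>i<n. snd (quotient_of (\<phi> (z ^ i))))"
  have Dpos: "D > 0" unfolding D_def
    by (intro prod_pos) (auto simp: quotient_of_denom_pos')
  have int_pow: "of_int D * \<phi> (z ^ i) \<in> \<int>" for i
  proof -
    let ?j = "i mod n"
    let ?d = "snd (quotient_of (\<phi> (z ^ ?j)))"
    have "z ^ i = z ^ (n * (i div n) + ?j)" by simp
    also have "\<dots> = z ^ ?j"
      unfolding power_add power_mult assms(1) by simp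
    finally have zi: "z ^ i = z ^ ?j" .
    have "?d dvd D" unfolding D_def using assms(2) by (intro dvd_prodI) auto
    then obtain c where c: "D = ?d * c" by (elim dvdE)
    have "\<phi> (z ^ ?j) = of_int (fst (quotient_of (\<phi> (z ^ ?j)))) / of_int ?d"
      by (rule quotient_of_div) simp
    moreover have "?d > 0" by (rule quotient_of_denom_pos')
    ultimately have "of_int D * \<phi> (z ^ ?j) = of_int (c * fst (quotient_of (\<phi> (z ^ ?j))))"
      by (subst c) (simp add: field_simps)
    then show ?thesis unfolding zi by (metis Ints_of_int)
  qed
  have scale_int: "\<phi> (of_int a * x) = of_int a * \<phi> x" for a x
    using scale[of "of_int a" x] by simp
  \<comment> \<open>The extra factor \<open>z ^ i\<close> lets the induction absorb the
    multiplication by \<open>z\<close> in \<open>pCons\<close>.\<close>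
  have int_eval: "of_int D * \<phi> (z ^ i * eval_at z h) \<in> \<int>" for h i
  proof (induction h arbitrary: i)
    case 0
    have "\<phi> 0 = 0" using scale[of 0 0] by simp
    then show ?case by simp
  next
    case (pCons a h)
    have "z ^ i * eval_at z (pCons a h) = of_int a * z ^ i + z ^ Suc i * eval_at z h"
      by (simp add: algebra_simps)
    then have "of_int D * \<phi> (z ^ i * eval_at z (pCons a h)) =
        of_int a * (of_int D * \<phi> (z ^ i)) + of_int D * \<phi> (z ^ Suc i * eval_at z h)"
      by (simp only: add scale_int) (simp add: algebra_simps)
    then show ?case using int_pow[of i] pCons(2)[of "Suc i"] by simp
  qed
  \<comment> \<open>The exponent \<open>D\<close> itself suffices: \<open>p ^ D\<close> would divide
    \<open>D\<close> although it exceeds \<open>D\<close>.\<close>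
  define m where "m = nat D"
  have "of_rat (of_nat (p ^ m)) * eval_at z (f ^ m) = 1"
    using eq by (simp add: power_mult_distrib[symmetric] of_rat_power)
  then have "of_nat (p ^ m) * \<phi> (eval_at z (f ^ m)) = 1"
    using scale[of "of_nat (p ^ m)" "eval_at z (f ^ m)"] one by metis
  moreover from int_eval[of 0 "f ^ m"] obtain c where "of_int D * \<phi> (eval_at z (f ^ m)) = of_int c"
    by (auto elim: Ints_cases)
  ultimately have "(of_int (int (p ^ m) * c) :: rat) = of_int D"
    by (metis (no_types, opaque_lifting) mult.left_commute mult.right_neutral of_int_mult of_int_of_nat_eq)
  then have "int (p ^ m) * c = D" by linarith
  then have "int (p ^ m) dvd D" by (metis dvd_triv_left)
  then have "int (p ^ m) \<le> D" using Dpos by (rule zdvd_imp_le)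
  moreover have "int m < int (p ^ m)" using assms(3) by (simp only: of_nat_less_iff power_gt_expt One_nat_def)
  moreover have "int m = D" using Dpos by (simp add: m_def)
  ultimately show False by linarith
qed

text \<open>Both sides are monic of degree \<open>n\<close> in \<open>w\<close>, so their difference
  has smaller degree; it vanishes at all \<open>n\<close> roots of unity and must be zero.\<close>

lemma power_minus_one_eq_prod_roots_of_unity:
  fixes n :: nat
  assumes "n > 0"
  defines "z \<equiv> cis (2 * pi / n)"
  shows "(w::complex) ^ n - 1 = (\<Prod>i<n. w - z ^ i)"
proof -
  have pow: "z ^ i = cis (2 * pi * real i / real n)" for i
    by (simp add: z_def DeMoivre field_simps)
  have bij: "bij_betw (\<lambda>i. z ^ i) {..<n} {w. w ^ n = 1}"
    unfolding pow using bij_betw_roots_unity[OF assms(1)] .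
  define P where "P = (monom 1 n - 1 :: complex poly)"
  define R where "R = (\<Prod>i<n. [:- (z ^ i), 1:])"
  have "degree R = n" unfolding R_def by (subst degree_prod_eq_sum_degree) auto
  moreover have "lead_coeff R = 1" unfolding R_def lead_coeff_prod by simp
  moreover have dP: "degree P = n"
    unfolding P_def diff_conv_add_uminus
    using assms(1) by (subst degree_add_eq_left) (auto simp: degree_monom_eq)
  moreover have "lead_coeff P = 1"
    unfolding dP using assms(1) by (simp add: P_def coeff_1)
  ultimately have "P = R"
  proof -
    assume *: "degree R = n" "lead_coeff R = 1" "degree P = n" "lead_coeff P = 1"
    have "P - R = 0"
    proof (rule ccontr)
      assume nz: "P - R \<noteq> 0"
      have "coeff (P - R) n = 0" using * by simp
      moreover have "degree (P - R) \<le> n" using * by (simp add: degree_diff_le)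
      ultimately have deg: "degree (P - R) < n"
        using nz by (metis leading_coeff_0_iff order_le_less)
      have "{w. w ^ n = 1} \<subseteq> {w. poly (P - R) w = 0}"
      proof safe
        fix w :: complex assume "w ^ n = 1"
        then obtain i where "i < n" "w = z ^ i" using bij by (auto simp: bij_betw_def)
        then show "poly (P - R) w = 0"
          using \<open>w ^ n = 1\<close> by (auto simp: P_def R_def poly_monom poly_prod intro!: bexI[of _ i])
      qed
      then have "card {w::complex. w ^ n = 1} \<le> card {w. poly (P - R) w = 0}"
        by (intro card_mono poly_roots_finite nz)
      also have "\<dots> \<le> degree (P - R)" by (rule card_poly_roots_bound[OF nz])
      finally show False using deg bij_betw_same_card[OF bij] by simp
    qed
    then show ?thesis by simp
  qed
  then have "poly P w = poly R w" by simp
  then show ?thesis by (simp add: P_def R_def poly_monom poly_prod)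
qed

text \<open>Cancelling \<open>w - 1\<close> in the factorisation of \<open>w ^ n - 1\<close> leaves
  the geometric sum, whose value at 1 is \<open>n\<close>. The cancellation requires
  \<open>w \<noteq> 1\<close>, so the value at 1 is reached as a limit.\<close>

lemma prod_one_minus_roots_of_unity:
  fixes n :: nat
  assumes "n > 0"
  defines "z \<equiv> cis (2 * pi / n)"
  shows "(\<Prod>i\<in>{1..<n}. 1 - z ^ i) = of_nat n"
proof -
  have eq: "(\<Sum>j<n. w ^ j) = (\<Prod>i\<in>{1..<n}. w - z ^ i)" if "w \<noteq> 1" for w
  proof -
    have "{..<n} = insert 0 {1..<n}" using assms(1) by auto
    then have "w ^ n - 1 = (w - 1) * (\<Prod>i\<in>{1..<n}. w - z ^ i)"
      using power_minus_one_eq_prod_roots_of_unity[OF assms(1), of w] by (simp add: z_def)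
    moreover have "w ^ n - 1 = (w - 1) * (\<Sum>j<n. w ^ j)"
      by (rule power_diff_1_eq)
    ultimately show ?thesis using that by simp
  qed
  have "((\<lambda>w. \<Sum>j<n. w ^ j) \<longlongrightarrow> (\<Sum>j<n. 1 ^ j)) (at (1::complex))"
    by (intro tendsto_intros)
  moreover have lim: "((\<lambda>w. \<Prod>i\<in>{1..<n}. w - z ^ i) \<longlongrightarrow> (\<Prod>i\<in>{1..<n}. 1 - z ^ i)) (at (1::complex))"
    by (intro tendsto_intros)
  moreover have "\<forall>\<^sub>F w in at (1::complex). (\<Sum>j<n. w ^ j) = (\<Prod>i\<in>{1..<n}. w - z ^ i)"
    using eq by (auto simp: eventually_at_filter)
  ultimately have "((\<lambda>w. \<Prod>i\<in>{1..<n}. w - z ^ i) \<longlongrightarrow> (\<Sum>j<n. 1 ^ j)) (at (1::complex))"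
    by (simp add: tendsto_cong)
  from tendsto_unique[OF at_neq_bot lim this] show ?thesis by simp
qed

text \<open>Put \<open>n = p ^ k - 1\<close> and let \<open>g\<close> be the indeterminate. Its
  class has order exactly \<open>n\<close>, because the product of all \<open>1 - x ^ i\<close> with
  \<open>0 < i < n\<close> is congruent to \<open>n\<close>, which is -1 modulo \<open>I\<close>.
  Every class is 0 or a power of it, because the Frobenius map fixes the class, which is then a root
  of the fully factored polynomial \<open>T ^ (n + 1) - T\<close>.\<close>

lemma exists_cyclic_residue_field:
  fixes p k :: nat
  assumes "prime p" "k \<ge> 1"
  obtains I :: "int poly set" and g where "prime_ideal I" "of_nat p \<in> I"
    "\<And>i. g ^ i - 1 \<in> I \<longleftrightarrow> (p ^ k - 1) dvd i"
    "\<And>f. f \<in> I \<or> (\<exists>i<p ^ k - 1. f - g ^ i \<in> I)"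
proof -
  have p2: "p \<ge> 2" using assms(1) by (rule prime_ge_2_nat)
  define n where "n = p ^ k - 1"
  have "p ^ 1 \<le> p ^ k" using p2 assms(2) by (intro power_increasing) auto
  then have n: "n > 0" "p ^ k = Suc n" using p2 by (auto simp: n_def)
  define z where "z = cis (2 * pi / n)"
  have zn: "z ^ n = 1" using n by (simp add: z_def DeMoivre)
  define x :: "int poly" where "x = [:0, 1:]"
  have evx: "eval_at z x = z" by (simp add: x_def)
  define J where "J = {f. \<exists>h. eval_at z f = of_nat p * eval_at z h}"
  have "ring_ideal J"
  proof
    show "0 \<in> J" by (auto simp: J_def intro: exI[of _ 0])
    show "a + b \<in> J" if "a \<in> J" "b \<in> J" for a b
      proof -
      from that obtain h h' where "eval_at z a = of_nat p * eval_at z h" "eval_at z b = of_nat p * eval_at z h'"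
        by (auto simp: J_def)
      then have "eval_at z (a + b) = of_nat p * eval_at z (h + h')" by (simp add: algebra_simps)
      then show ?thesis unfolding J_def by blast
    qed
    show "r * a \<in> J" if "a \<in> J" for r a
      proof -
      from that obtain h where "eval_at z a = of_nat p * eval_at z h" by (auto simp: J_def)
      then have "eval_at z (r * a) = of_nat p * eval_at z (r * h)" by (simp add: algebra_simps)
      then show ?thesis unfolding J_def by blast
    qed
  qed
  moreover have "1 \<notin> J"
    using inverse_integer_notin_cyclotomic_ring[OF zn n(1), of p] p2 by (auto simp: J_def)
  ultimately obtain I where I: "prime_ideal I" and JI: "J \<subseteq> I"
    by (rule proper_ideal_extends_to_prime)
  interpret prime_ideal I by fact
  have kernel: "f \<in> I" if "eval_at z f = 0" for f
    proof -
    have "eval_at z f = of_nat p * eval_at z 0" using that by simp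
    then show ?thesis using JI unfolding J_def by blast
  qed
  have pI: "of_nat p \<in> I"
  proof -
    have "eval_at z (of_nat p) = of_nat p * eval_at z 1" by simp
    then show ?thesis using JI unfolding J_def by blast
  qed
  have "of_nat (p ^ k) \<in> I"
  proof -
    have "p ^ k = p ^ (k - 1) * p" using assms(2) by (metis Suc_diff_le diff_Suc_1 One_nat_def power_Suc2)
    then show ?thesis using mult_mem[OF pI, of "of_nat (p ^ (k - 1))"] by simp
  qed
  then have "of_nat n + 1 \<in> I" by (simp add: n(2) add.commute)
  then have nI: "of_nat n \<notin> I"
    using diff_mem[of "of_nat n + 1" "of_nat n"] one_notin by fastforce
  have xn: "cg (x ^ n) (1)"
    unfolding cg_def by (rule kernel) (simp only: eval_at_diff eval_at_power evx zn eval_at_1 diff_self)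
  have ord: "cg (x ^ i) (1) \<longleftrightarrow> n dvd i" for i
  proof
    assume "n dvd i"
    then obtain c where "i = n * c" by (elim dvdE)
    then show "cg (x ^ i) (1)" using cg_power[OF xn, of c] by (simp add: power_mult)
  next
    assume i: "cg (x ^ i) (1)"
    let ?j = "i mod n"
    have "x ^ i = (x ^ n) ^ (i div n) * x ^ ?j"
      by (metis mult_div_mod_eq power_add power_mult)
    also have "cg \<dots> (1 ^ (i div n) * x ^ ?j)"
      by (intro cg_mult cg_power xn cg_refl)
    finally have "cg (x ^ i) (x ^ ?j)" by simp
    then have j: "cg (x ^ ?j) (1)" using cg_trans[OF cg_sym i] by blast
    show "n dvd i"
    proof (rule ccontr)
      assume "\<not> n dvd i"
      then have jmem: "?j \<in> {1..<n}" using n(1) by (auto simp: Suc_le_eq mod_greater_zero_iff_not_dvd)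
      have "1 - x ^ ?j \<in> I" using cg_sym[OF j] by (simp add: cg_def)
      then have "(\<Prod>i\<in>{1..<n}. 1 - x ^ i) \<in> I"
        using jmem by (intro prod_mem) auto
      moreover have "(\<Prod>i\<in>{1..<n}. 1 - x ^ i) - of_nat n \<in> I"
        by (rule kernel) (simp only: eval_at_diff eval_at_prod eval_at_power evx eval_at_1
            eval_at_of_nat, simp only: z_def prod_one_minus_roots_of_unity[OF n(1)] diff_self)
      ultimately show False
        using nI diff_mem[of "\<Prod>i\<in>{1..<n}. 1 - x ^ i" "(\<Prod>i\<in>{1..<n}. 1 - x ^ i) - of_nat n"] by simp
    qed
  qed
  \<comment> \<open>Integers are fixed by Fermat and the indeterminate because
    \<open>x ^ (n + 1)\<close> is congruent to \<open>x\<close>; additivity carries this to all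
    polynomials.\<close>
  have frob: "cg (f ^ (p ^ k)) (f)" for f
  proof (induction f)
    case 0
    then show ?case using n by simp
  next
    case (pCons a f)
    have eq: "pCons a h = of_int a + x * h" for h :: "int poly"
      by (simp add: of_int_poly x_def)
    have "cg ((of_int a + x * f) ^ (p ^ k)) (of_int a ^ (p ^ k) + (x * f) ^ (p ^ k))"
      by (rule frobenius[OF assms(1) pI])
    also have "cg \<dots> (of_int a + x * f)"
    proof (rule cg_add[OF fermat_of_int[OF assms(1) pI]])
      have "cg (x ^ (p ^ k) * f ^ (p ^ k)) ((1 * x) * f)"
        unfolding n(2) power_Suc2 using pCons(2) n(2) by (intro cg_mult xn cg_refl) (simp add: mult.commute)
      then show "cg ((x * f) ^ (p ^ k)) (x * f)" by (simp only: power_mult_distrib mult_1)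
    qed
    finally show ?case unfolding eq[symmetric] .
  qed
  have cover: "f \<in> I \<or> (\<exists>i<n. f - x ^ i \<in> I)" for f
  proof -
    \<comment> \<open>At \<open>z\<close> the product equals \<open>f ^ n - 1\<close>, so
      \<open>w\<close> and \<open>f ^ (n + 1) - f\<close> have the same value there and agree modulo
      \<open>I\<close>.\<close>
    define w where "w = f * (\<Prod>i<n. f - x ^ i)"
    have "f ^ p ^ k - f - w \<in> I"
      unfolding w_def
    proof (rule kernel)
      have prod: "eval_at z f ^ n - 1 = (\<Prod>i<n. eval_at z f - z ^ i)"
        unfolding z_def by (rule power_minus_one_eq_prod_roots_of_unity[OF n(1)])
      have "eval_at z f ^ Suc n - eval_at z f - eval_at z f * (\<Prod>i<n. eval_at z f - z ^ i) = 0"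
        unfolding prod[symmetric] by (simp add: algebra_simps)
      then show "eval_at z (f ^ p ^ k - f - f * (\<Prod>i<n. f - x ^ i)) = 0"
        unfolding eval_at_diff eval_at_prod eval_at_power eval_at_mult evx n(2) .
    qed
    then have "w \<in> I"
      using diff_mem[OF frob[of f, unfolded cg_def], of "f ^ p ^ k - f - w"] by simp
    then have "f \<in> I \<or> (\<Prod>i<n. f - x ^ i) \<in> I" unfolding w_def by (rule prime_mem)
    then show ?thesis using prod_memD[of "{..<n}"] by auto
  qed
  show ?thesis
    by (rule that[OF I pI, of x]) (use ord cover in \<open>auto simp: cg_def n_def\<close>)
qed

section \<open>The Hermitian unital\<close>

context prime_ideal
begin

text \<open>Since \<open>(C - B) * D = (C - D) * B + (D - B) * C\<close>, the value of the form
  \<open>h\<close> at \<open>(D, D')\<close> is, up to the factor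
  \<open>(C - B) * (C' - B')\<close>, a combination of its four values at \<open>B\<close> and
  \<open>C\<close>. When the three diagonal values vanish, only the two mixed ones remain. Primed
  letters are independent variables here and become conjugates later.\<close>

lemma chord_isotropic:
  fixes a b a' b' :: 'r
  defines "h \<equiv> \<lambda>x x'. a * x + b + a' * x' + b' - x * x'"
  assumes "h B B' \<in> I" "h C C' \<in> I" "h D D' \<in> I"
  shows "(C - D) * (D' - B') * h B C' + (D - B) * (C' - D') * h C B' \<in> I"
proof -
  have "(C - D) * (D' - B') * h B C' + (D - B) * (C' - D') * h C B' =
      (C - B) * (C' - B') * h D D' - (C - D) * (C' - D') * h B B' - (D - B) * (D' - B') * h C C'"
    unfolding h_def by (simp add: algebra_simps)
  also have "\<dots> \<in> I"
    using assms(2-4) by (intro diff_mem mult_mem)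
  finally show ?thesis .
qed

text \<open>For the form \<open>y + y' - x * x'\<close>, the last hypothesis concerns the Gram
  determinant of the points \<open>(A, u)\<close>, \<open>(B, v)\<close>, \<open>(C, w)\<close>, up
  to multiples of its diagonal entries. That determinant is the product of the two collinearity
  determinants in the conclusion, the matrix of the form having determinant 1.\<close>

lemma gram_determinant_mem:
  fixes A B C A' B' C' u v w u' v' w' :: 'r
  assumes diag: "u + u' - A * A' \<in> I" "v + v' - B * B' \<in> I" "w + w' - C * C' \<in> I"
    and "(v + w' - B * C') * (w + u' - C * A') * (u + v' - A * B') +
         (w + v' - C * B') * (u + w' - A * C') * (v + u' - B * A') \<in> I"
  shows "((B - A) * (w - u) - (C - A) * (v - u)) * ((B' - A') * (w' - u') - (C' - A') * (v' - u')) \<in> I"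
proof -
  let ?hA = "u + u' - A * A'" and ?hB = "v + v' - B * B'" and ?hC = "w + w' - C * C'"
  have "((B - A) * (w - u) - (C - A) * (v - u)) * ((B' - A') * (w' - u') - (C' - A') * (v' - u')) =
     ((v + w' - B * C') * (w + u' - C * A') * (u + v' - A * B') +
         (w + v' - C * B') * (u + w' - A * C') * (v + u' - B * A'))
     + (?hB * ?hC - (v + w' - B * C') * (w + v' - C * B')) * ?hA
     - (w + u' - C * A') * (u + w' - A * C') * ?hB
     - (u + v' - A * B') * (v + u' - B * A') * ?hC"
    by (simp add: algebra_simps)
  also have "\<dots> \<in> I"
    by (rule diff_mem[OF diff_mem[OF add_mem[OF assms(4) mult_mem[OF assms(1)]]
          mult_mem[OF assms(2)]] mult_mem[OF assms(3)]])
  finally show ?thesis .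
qed

text \<open>\<open>A\<close>, \<open>B\<close>, \<open>C\<close> are the vertices of a triangle and \<open>D\<close>, \<open>E\<close>, \<open>G\<close> its intersections with the line of slope
  \<open>a4\<close>; each point is represented by its first coordinate.\<close>

lemma menelaus:
  fixes a1 a2 a3 a4 b1 b2 b3 b4 A B C D E G :: 'r
  assumes "a2 * A + b2 \<approx> a3 * A + b3" "a1 * B + b1 \<approx> a3 * B + b3" "a1 * C + b1 \<approx> a2 * C + b2"
    and "a1 * D + b1 \<approx> a4 * D + b4" "a2 * E + b2 \<approx> a4 * E + b4" "a3 * G + b3 \<approx> a4 * G + b4"
    and "a1 - a4 \<notin> I" "a2 - a4 \<notin> I" "a3 - a4 \<notin> I"
  shows "(D - B) * (E - C) * (G - A) \<approx> - ((C - D) * (A - E) * (B - G))"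
proof -
  have B: "(a1 - a4) * (B - D) \<approx> (a3 - a4) * (B - G)"
    using diff_mem[OF add_mem[OF assms(2)[unfolded cg_def] assms(6)[unfolded cg_def]] assms(4)[unfolded cg_def]]
    by (simp add: cg_def algebra_simps)
  have C: "(a2 - a4) * (C - E) \<approx> (a1 - a4) * (C - D)"
    using diff_mem[OF diff_mem[OF assms(4)[unfolded cg_def] assms(3)[unfolded cg_def]] assms(5)[unfolded cg_def]]
    by (simp add: cg_def algebra_simps)
  have A: "(a3 - a4) * (A - G) \<approx> (a2 - a4) * (A - E)"
    using diff_mem[OF diff_mem[OF assms(5)[unfolded cg_def] assms(1)[unfolded cg_def]] assms(6)[unfolded cg_def]]
    by (simp add: cg_def algebra_simps)
  have "((a1 - a4) * (B - D)) * ((a2 - a4) * (C - E)) * ((a3 - a4) * (A - G)) \<approx>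
      ((a3 - a4) * (B - G)) * ((a1 - a4) * (C - D)) * ((a2 - a4) * (A - E))"
    by (intro cg_mult A B C)
  moreover have "((a1 - a4) * (B - D)) * ((a2 - a4) * (C - E)) * ((a3 - a4) * (A - G)) -
      ((a3 - a4) * (B - G)) * ((a1 - a4) * (C - D)) * ((a2 - a4) * (A - E)) =
      (a1 - a4) * ((a2 - a4) * ((a3 - a4) * ((B - D) * (C - E) * (A - G) - (C - D) * (A - E) * (B - G))))"
    by (simp add: algebra_simps)
  ultimately have "(a1 - a4) * ((a2 - a4) * ((a3 - a4) *
      ((B - D) * (C - E) * (A - G) - (C - D) * (A - E) * (B - G)))) \<in> I"
    unfolding cg_def by simp
  then have "(B - D) * (C - E) * (A - G) - (C - D) * (A - E) * (B - G) \<in> I"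
    using assms(7-9) prime_mem by blast
  moreover have "(D - B) * (E - C) * (G - A) - - ((C - D) * (A - E) * (B - G)) =
      - ((B - D) * (C - E) * (A - G) - (C - D) * (A - E) * (B - G))"
    by (simp add: algebra_simps)
  ultimately show ?thesis unfolding cg_def using minus_mem by metis
qed

end

section \<open>Conjugation, trace and norm in the field of order \<open>q\<^sup>2\<close>\<close>

locale hermitian_residue_field = prime_ideal I for I :: "'r::comm_ring_1 set" +
  fixes g :: 'r and p k q :: nat
  assumes prime: "prime p" and char_mem: "of_nat p \<in> I"
    and q_def: "q = p ^ k" and q_ge: "q \<ge> 2"
    and gen_ord: "g ^ i - 1 \<in> I \<longleftrightarrow> (q\<^sup>2 - 1) dvd i"
    and gen_cover: "f \<in> I \<or> (\<exists>i<q\<^sup>2 - 1. f - g ^ i \<in> I)"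
begin

abbreviation conj :: "'r \<Rightarrow> 'r" where "conj x \<equiv> x ^ q"

lemma conj_add: "conj (x + y) \<approx> conj x + conj y"
  unfolding q_def by (rule frobenius[OF prime char_mem])

lemma conj_minus: "conj (- x) \<approx> - conj x"
  unfolding q_def by (rule frobenius_minus[OF prime char_mem])

lemma conj_diff: "conj (x - y) \<approx> conj x - conj y"
  using cg_trans[OF conj_add cg_add[OF cg_refl conj_minus], of x y] by simp

lemma conj_line: "conj (a * x + b) \<approx> conj a * conj x + conj b"
  using conj_add[of "a * x" b] by (simp add: power_mult_distrib)

lemma n_factor: "q\<^sup>2 - 1 = (q - 1) * (q + 1)"
  by (simp add: power2_eq_square algebra_simps)

lemma n_pos: "q\<^sup>2 - 1 > 0"
  unfolding n_factor using q_ge by simp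

lemma gen_power_notin: "g ^ i \<notin> I"
proof
  assume "g ^ i \<in> I"
  then have "g \<in> I" by (rule power_mem)
  then have "g * g ^ (q\<^sup>2 - 1 - 1) \<in> I" by (rule mult_mem')
  also have "g * g ^ (q\<^sup>2 - 1 - 1) = g ^ (q\<^sup>2 - 1)"
    using n_pos by (metis Suc_diff_1 power_Suc)
  finally have "g ^ (q\<^sup>2 - 1) \<in> I" .
  moreover have "g ^ (q\<^sup>2 - 1) - 1 \<in> I" using gen_ord by simp
  ultimately have "g ^ (q\<^sup>2 - 1) - (g ^ (q\<^sup>2 - 1) - 1) \<in> I" by (rule diff_mem)
  then show False using one_notin by simp
qed

lemma gen_power_cg: "g ^ i \<approx> g ^ j \<longleftrightarrow> int (q\<^sup>2 - 1) dvd int j - int i"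
proof -
  have *: "g ^ i \<approx> g ^ j \<longleftrightarrow> int (q\<^sup>2 - 1) dvd int j - int i" if "i \<le> j" for i j
  proof -
    have "g ^ j - g ^ i = g ^ i * (g ^ (j - i) - 1)"
      using that by (simp add: algebra_simps flip: power_add)
    then have "g ^ i \<approx> g ^ j \<longleftrightarrow> g ^ (j - i) - 1 \<in> I"
      using prime_mem gen_power_notin mult_mem cg_sym by (metis cg_def)
    also have "\<dots> \<longleftrightarrow> int (q\<^sup>2 - 1) dvd int (j - i)"
      by (simp only: gen_ord int_dvd_int_iff)
    finally show ?thesis using that by (simp add: of_nat_diff)
  qed
  show ?thesis
  proof (cases "i \<le> j")
    case False
    then show ?thesis
      using *[of j i] cg_sym dvd_diff_commute by (metis nat_le_linear)
  qed (rule *)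
qed

lemma conj_conj: "conj (conj x) \<approx> x"
proof -
  have pow: "conj (conj (g ^ i)) \<approx> g ^ i" for i
  proof -
    have "int i - int (i * q * q) = int (q\<^sup>2 - 1) * (- int i)"
      using n_pos by (subst of_nat_diff) (use q_ge in \<open>auto simp: power2_eq_square algebra_simps\<close>)
    then show ?thesis
      unfolding power_mult[symmetric] gen_power_cg by (metis dvd_triv_left)
  qed
  consider "x \<in> I" | i where "x \<approx> g ^ i" using gen_cover[of x] by (auto simp: cg_def)
  then show ?thesis
  proof cases
    case 1
    have "conj (conj x) = x * x ^ (q * q - 1)"
      using q_ge by (simp flip: power_mult power_Suc)
    then show ?thesis using 1 diff_mem mult_mem' by (simp add: cg_def)
  next
    case 2
    have "conj (conj x) \<approx> conj (conj (g ^ i))" using 2 by (intro cg_power)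
    also have "\<dots> \<approx> g ^ i" by (rule pow)
    also have "\<dots> \<approx> x" by (rule cg_sym[OF 2])
    finally show ?thesis .
  qed
qed

text \<open>A system of representatives of the residue classes, which turns counting field elements
  into counting a finite set.\<close>

definition F :: "'r set" where "F = insert 0 ((\<lambda>i. g ^ i) ` {..<q\<^sup>2 - 1})"

lemma finite_F [simp]: "finite F" by (simp add: F_def)

lemma gen_power_inj:
  assumes "g ^ i \<approx> g ^ j" "i < q\<^sup>2 - 1" "j < q\<^sup>2 - 1"
  shows "i = j"
proof -
  have "int (q\<^sup>2 - 1) dvd int j - int i" using assms(1) by (simp only: gen_power_cg)
  moreover have "\<bar>int j - int i\<bar> < int (q\<^sup>2 - 1)" using assms(2,3) by linarith
  ultimately show ?thesis
    using dvd_imp_le_int[of "int j - int i" "int (q\<^sup>2 - 1)"] by fastforce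
qed

lemma F_unique: "x \<in> F \<Longrightarrow> y \<in> F \<Longrightarrow> x \<approx> y \<Longrightarrow> x = y"
  using gen_power_inj gen_power_notin cg_sym by (fastforce simp: F_def)

lemma card_F: "card F = q\<^sup>2"
proof -
  have "inj_on (\<lambda>i. g ^ i) {..<q\<^sup>2 - 1}"
    using gen_power_inj by (auto intro!: inj_onI)
  moreover have "0 \<notin> (\<lambda>i. g ^ i) ` {..<q\<^sup>2 - 1}"
    using gen_power_notin zero_mem by (metis imageE)
  ultimately show ?thesis
    using n_pos by (simp add: F_def card_image)
qed

definition rep :: "'r \<Rightarrow> 'r" where "rep x = (SOME y. y \<in> F \<and> x \<approx> y)"

lemma rep: "rep x \<in> F" "x \<approx> rep x" "rep x \<approx> x"
proof -
  have "\<exists>y. y \<in> F \<and> x \<approx> y"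
    using gen_cover[of x] by (auto simp: F_def cg_def)
  from someI_ex[OF this] show "rep x \<in> F" "x \<approx> rep x" "rep x \<approx> x"
    using cg_sym by (auto simp: rep_def)
qed

lemma rep_eqD: "rep x = rep y \<Longrightarrow> x \<approx> y"
  using rep(2)[of x] rep(3)[of y] cg_trans by simp

lemma dvd_shift:
  assumes "int (q\<^sup>2 - 1) dvd int (q - 1) * c"
  shows "int (q + 1) dvd c"
  using assms q_ge unfolding n_factor of_nat_mult by (simp only: dvd_mult_cancel_left) simp

text \<open>Eliminating between two nonzero solutions \<open>g ^ i\<close> and \<open>g ^ j\<close>
  gives \<open>g ^ (i * q + j)\<close> congruent to \<open>g ^ (j * q + i)\<close>, so
  \<open>i\<close> and \<open>j\<close> agree modulo \<open>q + 1\<close>. This leaves at most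
  \<open>q - 1\<close> exponents, and 0 is the remaining solution.\<close>

lemma card_trace_kernel: "card {y \<in> F. conj y + y \<in> I} \<le> q"
proof (cases "\<exists>i<q\<^sup>2 - 1. conj (g ^ i) + g ^ i \<in> I")
  case False
  then have "{y \<in> F. conj y + y \<in> I} \<subseteq> {0}" by (auto simp: F_def)
  then have "card {y \<in> F. conj y + y \<in> I} \<le> card {0::'r}" by (intro card_mono) auto
  then show ?thesis using q_ge by simp
next
  case True
  then obtain i where i: "conj (g ^ i) + g ^ i \<in> I" by blast
  have diff: "int (q + 1) dvd int j - int i" if j: "conj (g ^ j) + g ^ j \<in> I" for j
  proof -
    have "(conj (g ^ i) + g ^ i) * g ^ j - (conj (g ^ j) + g ^ j) * g ^ i \<in> I"
      using i j by (intro diff_mem mult_mem')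
    then have "g ^ (i * q + j) \<approx> g ^ (j * q + i)"
      by (simp add: cg_def algebra_simps power_add power_mult)
    then have "int (q\<^sup>2 - 1) dvd int (j * q + i) - int (i * q + j)" by (simp only: gen_power_cg)
    also have "int (j * q + i) - int (i * q + j) = int (q - 1) * (int j - int i)"
      using q_ge by (simp add: of_nat_diff algebra_simps)
    finally show ?thesis by (rule dvd_shift)
  qed
  let ?r = "i mod (q + 1)"
  have "{y \<in> F. conj y + y \<in> I} \<subseteq> insert 0 ((\<lambda>t. g ^ (?r + (q + 1) * t)) ` {..<q - 1})"
  proof
    fix y assume "y \<in> {y \<in> F. conj y + y \<in> I}"
    then consider "y = 0" | j where "y = g ^ j" "j < q\<^sup>2 - 1" "conj (g ^ j) + g ^ j \<in> I"
      by (auto simp: F_def)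
    then show "y \<in> insert 0 ((\<lambda>t. g ^ (?r + (q + 1) * t)) ` {..<q - 1})"
    proof cases
      case 2
      have "int j mod int (q + 1) = int i mod int (q + 1)"
        using diff[OF 2(3)] by (simp only: mod_eq_dvd_iff)
      then have "j mod (q + 1) = ?r" by (metis of_nat_mod of_nat_eq_iff)
      then have "j = ?r + (q + 1) * (j div (q + 1))" by (metis mod_mult_div_eq)
      then have "y = g ^ (?r + (q + 1) * (j div (q + 1)))" using 2(1) by simp
      moreover have "j div (q + 1) < q - 1"
        using 2(2) unfolding n_factor by (simp add: less_mult_imp_div_less)
      ultimately show ?thesis by blast
    qed simp
  qed
  then have "card {y \<in> F. conj y + y \<in> I} \<le> card (insert 0 ((\<lambda>t. g ^ (?r + (q + 1) * t)) ` {..<q - 1}))"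
    by (intro card_mono) auto
  also have "\<dots> \<le> Suc (card ((\<lambda>t. g ^ (?r + (q + 1) * t)) ` {..<q - 1}))"
    by (rule card_insert_le_m1) auto
  also have "\<dots> \<le> Suc (card {..<q - 1})" using card_image_le by blast
  finally show ?thesis using q_ge by simp
qed

text \<open>Subtracting one fixed solution maps the fibre injectively into the kernel of the
  trace.\<close>

lemma card_trace_fibre: "card {y \<in> F. conj y + y \<approx> c} \<le> q"
proof (cases "{y \<in> F. conj y + y \<approx> c} = {}")
  case False
  then obtain y0 where y0: "y0 \<in> F" "conj y0 + y0 \<approx> c" by blast
  have "card {y \<in> F. conj y + y \<approx> c} \<le> card {y \<in> F. conj y + y \<in> I}"
  proof (rule card_inj_on_le[of "\<lambda>y. rep (y - y0)"])
    show "inj_on (\<lambda>y. rep (y - y0)) {y \<in> F. conj y + y \<approx> c}"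
    proof (rule inj_onI)
      fix x y assume *: "x \<in> {y \<in> F. conj y + y \<approx> c}" "y \<in> {y \<in> F. conj y + y \<approx> c}"
        "rep (x - y0) = rep (y - y0)"
      then have "x \<approx> y" using rep_eqD[OF *(3)] by (simp add: cg_def)
      then show "x = y" using * F_unique by blast
    qed
    show "(\<lambda>y. rep (y - y0)) ` {y \<in> F. conj y + y \<approx> c} \<subseteq> {y \<in> F. conj y + y \<in> I}"
    proof safe
      fix y assume y: "y \<in> F" "conj y + y \<approx> c"
      show "rep (y - y0) \<in> F" by (rule rep)
      have "conj (rep (y - y0)) + rep (y - y0) \<approx> conj (y - y0) + (y - y0)"
        by (intro cg_add cg_power rep)
      also have "\<dots> \<approx> (conj y - conj y0) + (y - y0)"
        by (intro cg_add conj_diff cg_refl)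
      also have "\<dots> = (conj y + y) - (conj y0 + y0)" by simp
      also have "\<dots> \<approx> c - c" by (intro cg_diff y y0)
      finally show "conj (rep (y - y0)) + rep (y - y0) \<in> I" by simp
    qed
  qed simp
  also have "\<dots> \<le> q" by (rule card_trace_kernel)
  finally show ?thesis .
qed (simp only: card.empty le0)

text \<open>Writing \<open>c\<close> as \<open>g ^ j\<close>, invariance under conjugation forces
  \<open>j = (q + 1) * i\<close>. The elements \<open>g ^ (i + (q - 1) * t)\<close> with
  \<open>t \<le> q\<close> then all have norm \<open>c\<close> and are distinct.\<close>

lemma card_norm_fibre:
  assumes "c \<notin> I" "conj c \<approx> c"
  shows "q + 1 \<le> card {z \<in> F. z * conj z \<approx> c}"
proof -
  obtain j where j: "c \<approx> g ^ j" using gen_cover[of c] assms(1) by (auto simp: cg_def)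
  have "g ^ j \<approx> c" by (rule cg_sym[OF j])
  also have "c \<approx> conj c" by (rule cg_sym[OF assms(2)])
  also have "conj c \<approx> conj (g ^ j)" by (rule cg_power[OF j])
  finally have "int (q\<^sup>2 - 1) dvd int (j * q) - int j"
    by (simp only: power_mult[symmetric] gen_power_cg)
  also have "int (j * q) - int j = int (q - 1) * int j"
    using q_ge by (simp add: of_nat_diff algebra_simps)
  finally have "int (q + 1) dvd int j" by (rule dvd_shift)
  then obtain i where i: "j = (q + 1) * i" by (auto simp only: int_dvd_int_iff elim: dvdE)
  have "inj_on (\<lambda>t. rep (g ^ (i + (q - 1) * t))) {..<q + 1}"
  proof (rule inj_onI)
    fix s t assume st: "s \<in> {..<q + 1}" "t \<in> {..<q + 1}"
      "rep (g ^ (i + (q - 1) * s)) = rep (g ^ (i + (q - 1) * t))"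
    have "int (q\<^sup>2 - 1) dvd int (i + (q - 1) * t) - int (i + (q - 1) * s)"
      using rep_eqD[OF st(3)] by (simp only: gen_power_cg)
    also have "int (i + (q - 1) * t) - int (i + (q - 1) * s) = int (q - 1) * (int t - int s)"
      by (simp only: of_nat_add of_nat_mult right_diff_distrib)
    finally have "int (q + 1) dvd int t - int s" by (rule dvd_shift)
    moreover have "\<bar>int t - int s\<bar> < int (q + 1)" using st(1,2) by auto
    ultimately show "s = t"
      using dvd_imp_le_int[of "int t - int s" "int (q + 1)"] by fastforce
  qed
  moreover have "(\<lambda>t. rep (g ^ (i + (q - 1) * t))) ` {..<q + 1} \<subseteq> {z \<in> F. z * conj z \<approx> c}"
  proof safe
    fix t
    let ?e = "i + (q - 1) * t"
    show "rep (g ^ ?e) \<in> F" by (rule rep)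
    have "rep (g ^ ?e) * conj (rep (g ^ ?e)) \<approx> g ^ ?e * conj (g ^ ?e)"
      by (intro cg_mult cg_power rep)
    also have "\<dots> = g ^ (?e * (q + 1))"
      by (simp add: power_add power_mult)
    also have "?e * (q + 1) = j + (q\<^sup>2 - 1) * t"
      unfolding i n_factor by (simp add: algebra_simps)
    also have "g ^ (j + (q\<^sup>2 - 1) * t) \<approx> g ^ j"
      unfolding gen_power_cg by simp
    also have "g ^ j \<approx> c" by (rule cg_sym[OF j])
    finally show "rep (g ^ ?e) * conj (rep (g ^ ?e)) \<approx> c" .
  qed
  ultimately have "card {..<q + 1} \<le> card {z \<in> F. z * conj z \<approx> c}"
    by (intro card_inj_on_le) auto
  then show ?thesis by simp
qed

end

section \<open>O'Nan configurations\<close>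

context hermitian_residue_field
begin

lemma conj_notin: "x \<notin> I \<Longrightarrow> conj x \<notin> I"
  using power_mem by blast

text \<open>On each side of the triangle \<open>A\<close>, \<open>B\<close>, \<open>C\<close>,
  \<open>chord_isotropic\<close> relates the form value of the two ends to the value in reverse
  order, through the ratio in which the fourth line divides the side. Multiplying the three
  relations and cancelling by Menelaus shows that the Gram determinant of the triangle vanishes. Its
  vertices would then be collinear, which distinct vertices and slopes forbid.\<close>

lemma no_onan_coordinates:
  fixes a1 a2 a3 a4 b1 b2 b3 b4 A B C D E G :: 'r
  defines "h \<equiv> \<lambda>a b x y. a * x + b + conj a * conj y + conj b - x * conj y"
  assumes meet: "a2 * A + b2 \<approx> a3 * A + b3" "a1 * B + b1 \<approx> a3 * B + b3" "a1 * C + b1 \<approx> a2 * C + b2"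
    "a1 * D + b1 \<approx> a4 * D + b4" "a2 * E + b2 \<approx> a4 * E + b4" "a3 * G + b3 \<approx> a4 * G + b4"
    and slopes: "a1 - a4 \<notin> I" "a2 - a4 \<notin> I" "a3 - a4 \<notin> I" "a2 - a3 \<notin> I"
    and iso1: "h a1 b1 B B \<in> I" "h a1 b1 C C \<in> I" "h a1 b1 D D \<in> I"
    and iso2: "h a2 b2 C C \<in> I" "h a2 b2 A A \<in> I" "h a2 b2 E E \<in> I"
    and iso3: "h a3 b3 A A \<in> I" "h a3 b3 B B \<in> I" "h a3 b3 G G \<in> I"
    and distinct: "B - A \<notin> I" "C - A \<notin> I" "C - D \<notin> I" "A - E \<notin> I" "B - G \<notin> I"
  shows False
proof -
  let ?X = "C - D" and ?X2 = "D - B" and ?Y = "A - E" and ?Y2 = "E - C" and ?Z = "B - G" and ?Z2 = "G - A"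
  define \<alpha> where "\<alpha> = h a1 b1 B C"
  define \<alpha>' where "\<alpha>' = h a1 b1 C B"
  define \<beta> where "\<beta> = h a2 b2 C A"
  define \<beta>' where "\<beta>' = h a2 b2 A C"
  define \<gamma> where "\<gamma> = h a3 b3 A B"
  define \<gamma>' where "\<gamma>' = h a3 b3 B A"
  \<comment> \<open>The relation for a side with ends \<open>S\<close>, \<open>T\<close> and a third
    point \<open>U\<close> of the unital, now with conjugates for the primed variables.\<close>
  have side: "P * conj Q' * s \<approx> - (Q' * conj P * s')"
    if "h a b S S \<in> I" "h a b T T \<in> I" "h a b U U \<in> I" "P = T - U" "Q' = U - S"
      "s = h a b S T" "s' = h a b T S" for a b S T U P Q' s s'
  proof -
    have "P * conj Q' * s \<approx> P * (conj U - conj S) * s"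
      unfolding that(5) by (rule cg_mult[OF cg_mult[OF cg_refl conj_diff] cg_refl])
    also have "\<dots> \<approx> - (Q' * (conj T - conj U) * s')"
      using chord_isotropic[of a S b "conj a" "conj S" "conj b" T "conj T" U "conj U"] that(1-3)
      unfolding h_def cg_def diff_minus_eq_add that(4-7) by blast
    also have "\<dots> \<approx> - (Q' * conj P * s')"
      unfolding that(4) by (rule cg_minus[OF cg_mult[OF cg_mult[OF cg_refl cg_sym[OF conj_diff]] cg_refl]])
    finally show ?thesis .
  qed
  let ?W = "?X * ?Y * ?Z"
  have W: "?W \<notin> I" using distinct by (intro mult_notin)
  have men: "?X2 * ?Y2 * ?Z2 \<approx> - ?W"
    by (rule menelaus[OF meet slopes(1-3)])
  have "conj (?X2 * ?Y2 * ?Z2) \<approx> conj (- ?W)" by (rule cg_power[OF men])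
  also have "\<dots> \<approx> - conj ?W" by (rule conj_minus)
  finally have men': "conj (?X2 * ?Y2 * ?Z2) \<approx> - conj ?W" .
  have "(?X * conj ?X2 * \<alpha>) * (?Y * conj ?Y2 * \<beta>) * (?Z * conj ?Z2 * \<gamma>) \<approx>
      - (?X2 * conj ?X * \<alpha>') * - (?Y2 * conj ?Y * \<beta>') * - (?Z2 * conj ?Z * \<gamma>')"
    by (rule cg_mult[OF cg_mult[OF side[OF iso1 refl refl \<alpha>_def \<alpha>'_def]
          side[OF iso2 refl refl \<beta>_def \<beta>'_def]] side[OF iso3 refl refl \<gamma>_def \<gamma>'_def]])
  moreover have "(?X * conj ?X2 * \<alpha>) * (?Y * conj ?Y2 * \<beta>) * (?Z * conj ?Z2 * \<gamma>) =
      ?W * conj (?X2 * ?Y2 * ?Z2) * (\<alpha> * \<beta> * \<gamma>)"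
    by (simp only: power_mult_distrib mult_ac)
  moreover have "- (?X2 * conj ?X * \<alpha>') * - (?Y2 * conj ?Y * \<beta>') * - (?Z2 * conj ?Z * \<gamma>') =
      - ((?X2 * ?Y2 * ?Z2) * conj ?W * (\<alpha>' * \<beta>' * \<gamma>'))"
    by (simp only: power_mult_distrib mult_ac mult_minus_left mult_minus_right minus_minus)
  ultimately have eq: "?W * conj (?X2 * ?Y2 * ?Z2) * (\<alpha> * \<beta> * \<gamma>) \<approx>
      - ((?X2 * ?Y2 * ?Z2) * conj ?W * (\<alpha>' * \<beta>' * \<gamma>'))" by simp
  have "?W * - conj ?W * (\<alpha> * \<beta> * \<gamma>) \<approx> ?W * conj (?X2 * ?Y2 * ?Z2) * (\<alpha> * \<beta> * \<gamma>)"
    by (rule cg_mult[OF cg_mult[OF cg_refl cg_sym[OF men']] cg_refl])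
  also note eq
  also have "- ((?X2 * ?Y2 * ?Z2) * conj ?W * (\<alpha>' * \<beta>' * \<gamma>')) \<approx> - (- ?W * conj ?W * (\<alpha>' * \<beta>' * \<gamma>'))"
    by (rule cg_minus[OF cg_mult[OF cg_mult[OF men cg_refl] cg_refl]])
  finally have "?W * - conj ?W * (\<alpha> * \<beta> * \<gamma>) - - (- ?W * conj ?W * (\<alpha>' * \<beta>' * \<gamma>')) \<in> I"
    by (simp only: cg_def)
  also have "?W * - conj ?W * (\<alpha> * \<beta> * \<gamma>) - - (- ?W * conj ?W * (\<alpha>' * \<beta>' * \<gamma>')) =
      - (?W * (conj ?W * (\<alpha> * \<beta> * \<gamma> + \<alpha>' * \<beta>' * \<gamma>')))"
  proof -
    have "w * - v * s - - (- w * v * t) = - (w * (v * (s + t)))" for w v s t :: 'r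
      by (simp add: algebra_simps)
    then show ?thesis .
  qed
  finally have "?W * (conj ?W * (\<alpha> * \<beta> * \<gamma> + \<alpha>' * \<beta>' * \<gamma>')) \<in> I"
    using minus_mem[of "- (?W * (conj ?W * (\<alpha> * \<beta> * \<gamma> + \<alpha>' * \<beta>' * \<gamma>')))"] unfolding minus_minus by blast
  then have sum: "\<alpha> * \<beta> * \<gamma> + \<alpha>' * \<beta>' * \<gamma>' \<in> I"
    using W conj_notin[OF W] mult_notin by blast
  define u where "u = a2 * A + b2"
  define v where "v = a3 * B + b3"
  define w where "w = a1 * C + b1"
  define u' where "u' = conj a2 * conj A + conj b2"
  define v' where "v' = conj a3 * conj B + conj b3"
  define w' where "w' = conj a1 * conj C + conj b1"
  have conj_meet: "conj a * conj x + conj b \<approx> conj a' * conj x + conj b'"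
    if "a * x + b \<approx> a' * x + b'" for a b a' b' x
    using cg_trans[OF cg_sym[OF conj_line] cg_trans[OF cg_power[OF that] conj_line]] .
  have h_split: "h a b x y = (a * x + b) + (conj a * conj y + conj b) - x * conj y" for a b x y
    by (simp add: h_def)
  have "(v + w' - B * conj C) * (w + u' - C * conj A) * (u + v' - A * conj B) +
      (w + v' - C * conj B) * (u + w' - A * conj C) * (v + u' - B * conj A) \<approx>
      \<alpha> * \<beta> * \<gamma> + \<alpha>' * \<beta>' * \<gamma>'"
    unfolding \<alpha>_def \<alpha>'_def \<beta>_def \<beta>'_def \<gamma>_def \<gamma>'_def h_split u_def v_def w_def u'_def v'_def w'_def
    by (rule cg_add[OF
          cg_mult[OF cg_mult[OF cg_diff[OF cg_add[OF cg_sym[OF meet(2)] cg_refl] cg_refl]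
              cg_diff[OF cg_add[OF meet(3) cg_refl] cg_refl]]
            cg_diff[OF cg_add[OF meet(1) cg_refl] cg_refl]]
          cg_mult[OF cg_mult[OF cg_diff[OF cg_add[OF cg_refl cg_sym[OF conj_meet[OF meet(2)]]] cg_refl]
              cg_diff[OF cg_add[OF cg_refl conj_meet[OF meet(3)]] cg_refl]]
            cg_diff[OF cg_add[OF cg_refl conj_meet[OF meet(1)]] cg_refl]]])
  then have "(v + w' - B * conj C) * (w + u' - C * conj A) * (u + v' - A * conj B) +
      (w + v' - C * conj B) * (u + w' - A * conj C) * (v + u' - B * conj A) \<in> I"
    using cg_trans[of _ _ 0] sum unfolding cg_zero_iff by blast
  moreover have "u + u' - A * conj A \<in> I" "v + v' - B * conj B \<in> I" "w + w' - C * conj C \<in> I"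
    using iso2(2) iso3(2) iso1(2) by (simp_all only: h_split u_def v_def w_def u'_def v'_def w'_def)
  ultimately have det: "((B - A) * (w - u) - (C - A) * (v - u)) *
      ((conj B - conj A) * (w' - u') - (conj C - conj A) * (v' - u')) \<in> I"
    by (intro gram_determinant_mem) assumption+
  have "(B - A) * (w - u) - (C - A) * (v - u) \<approx>
      (B - A) * ((a2 * C + b2) - (a2 * A + b2)) - (C - A) * ((a3 * B + b3) - (a3 * A + b3))"
    unfolding u_def v_def w_def
    by (rule cg_diff[OF cg_mult[OF cg_refl cg_diff[OF meet(3) cg_refl]]
          cg_mult[OF cg_refl cg_diff[OF cg_refl meet(1)]]])
  also have "\<dots> = (B - A) * ((C - A) * (a2 - a3))" by (simp add: algebra_simps)
  finally have d: "(B - A) * (w - u) - (C - A) * (v - u) \<approx> (B - A) * ((C - A) * (a2 - a3))" .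
  have "(conj B - conj A) * (w' - u') - (conj C - conj A) * (v' - u') \<approx>
      (conj B - conj A) * ((conj a2 * conj C + conj b2) - (conj a2 * conj A + conj b2)) -
      (conj C - conj A) * ((conj a3 * conj B + conj b3) - (conj a3 * conj A + conj b3))"
    unfolding u'_def v'_def w'_def
    by (rule cg_diff[OF cg_mult[OF cg_refl cg_diff[OF conj_meet[OF meet(3)] cg_refl]]
          cg_mult[OF cg_refl cg_diff[OF cg_refl conj_meet[OF meet(1)]]]])
  also have "\<dots> = (conj B - conj A) * ((conj C - conj A) * (conj a2 - conj a3))"
    by (simp add: algebra_simps)
  also have "\<dots> \<approx> conj (B - A) * (conj (C - A) * conj (a2 - a3))"
    by (rule cg_mult[OF cg_sym[OF conj_diff] cg_mult[OF cg_sym[OF conj_diff] cg_sym[OF conj_diff]]])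
  finally have d': "(conj B - conj A) * (w' - u') - (conj C - conj A) * (v' - u') \<approx>
      conj (B - A) * (conj (C - A) * conj (a2 - a3))" .
  have "((B - A) * ((C - A) * (a2 - a3))) * (conj (B - A) * (conj (C - A) * conj (a2 - a3))) \<in> I"
    using cg_trans[OF cg_sym[OF cg_mult[OF d d']], of 0] det unfolding cg_zero_iff by blast
  moreover have "((B - A) * ((C - A) * (a2 - a3))) * (conj (B - A) * (conj (C - A) * conj (a2 - a3))) \<notin> I"
    using distinct(1,2) slopes(4) by (intro mult_notin conj_notin)
  ultimately show False by blast
qed

section \<open>Points of the unital and its non-tangent lines\<close>

definition points :: "('r \<times> 'r) set" where
  "points = Sigma F (\<lambda>x. {y \<in> F. conj y + y \<approx> x * conj x})"

text \<open>Substituting \<open>y = a * x + b\<close> into the equation of the unital says that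
  \<open>x - conj a\<close> has norm \<open>conj b + b + a * conj a\<close>. The removed pairs are
  those where this norm is 0, that is, the tangents.\<close>

definition secants :: "('r \<times> 'r) set" where
  "secants = F \<times> F - Sigma F (\<lambda>a. {b \<in> F. conj b + b \<approx> - (a * conj a)})"

definition on_secant :: "'r \<times> 'r \<Rightarrow> ('r \<times> 'r) set" where
  "on_secant l = {(x, y) \<in> points. y \<approx> fst l * x + snd l}"

lemma finite_points: "finite points"
  unfolding points_def by (intro finite_SigmaI) auto

lemma card_Sigma_F_le:
  assumes "\<And>x. x \<in> F \<Longrightarrow> card (f x) \<le> q" "\<And>x. finite (f x)"
  shows "card (Sigma F f) \<le> q ^ 3"
proof -
  have "card (Sigma F f) = (\<Sum>x\<in>F. card (f x))" using assms(2) by simp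
  also have "\<dots> \<le> (\<Sum>x\<in>F. q)" by (intro sum_mono assms(1))
  also have "\<dots> = q ^ 3" by (simp add: card_F power2_eq_square power3_eq_cube)
  finally show ?thesis .
qed

lemma card_points: "card points \<le> q ^ 3"
  unfolding points_def by (intro card_Sigma_F_le card_trace_fibre) auto

lemma card_secants: "q ^ 4 - q ^ 3 \<le> card secants"
proof -
  let ?T = "Sigma F (\<lambda>a. {b \<in> F. conj b + b \<approx> - (a * conj a)})"
  have "card ?T \<le> q ^ 3"
    by (intro card_Sigma_F_le card_trace_fibre) auto
  moreover have "card (F \<times> F) = q ^ 4"
    by (simp add: card_cartesian_product card_F flip: power_add)
  moreover have "card secants = card (F \<times> F) - card ?T"
    unfolding secants_def by (intro card_Diff_subset) auto
  ultimately show ?thesis by simp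
qed

lemma on_secant_subset: "on_secant l \<subseteq> points"
  by (auto simp: on_secant_def)

text \<open>The first coordinates are \<open>z + conj a\<close>, where \<open>z\<close> has norm
  \<open>c = conj b + b + a * conj a\<close>. This \<open>c\<close> is fixed by conjugation, and it
  is nonzero because the line is not tangent, so \<open>card_norm_fibre\<close> supplies
  \<open>q + 1\<close> choices of \<open>z\<close>.\<close>

lemma card_on_secant:
  assumes "l \<in> secants"
  shows "q + 1 \<le> card (on_secant l)"
proof -
  obtain a b where l: "l = (a, b)" by (cases l)
  define c where "c = conj b + b + a * conj a"
  have "c \<notin> I" using assms by (auto simp: l c_def secants_def cg_def)
  moreover have "conj c \<approx> c"
  proof -
    have "conj c \<approx> (conj (conj b) + conj b) + conj (a * conj a)"
      unfolding c_def by (intro cg_trans[OF conj_add] cg_add conj_add cg_refl)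
    also have "\<dots> = (conj (conj b) + conj b) + conj a * conj (conj a)"
      by (simp only: power_mult_distrib)
    also have "\<dots> \<approx> (b + conj b) + conj a * a"
      by (intro cg_add cg_mult conj_conj cg_refl)
    also have "\<dots> = c" by (simp add: c_def algebra_simps)
    finally show ?thesis .
  qed
  ultimately have "q + 1 \<le> card {z \<in> F. z * conj z \<approx> c}" by (rule card_norm_fibre)
  also have "\<dots> \<le> card (on_secant l)"
  proof (rule card_inj_on_le)
    let ?x = "\<lambda>z. rep (z + conj a)" and ?y = "\<lambda>z. rep (a * rep (z + conj a) + b)"
    show "inj_on (\<lambda>z. (?x z, ?y z)) {z \<in> F. z * conj z \<approx> c}"
    proof (rule inj_onI)
      fix z z' assume *: "z \<in> {z \<in> F. z * conj z \<approx> c}" "z' \<in> {z \<in> F. z * conj z \<approx> c}"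
        "(?x z, ?y z) = (?x z', ?y z')"
      then have "z + conj a \<approx> z' + conj a" using rep_eqD by blast
      then have "z \<approx> z'" by (simp add: cg_def)
      then show "z = z'" using * F_unique by blast
    qed
    show "(\<lambda>z. (?x z, ?y z)) ` {z \<in> F. z * conj z \<approx> c} \<subseteq> on_secant l"
    proof safe
      fix z assume z: "z * conj z \<approx> c"
      let ?s = "z + conj a"
      have s': "conj ?s \<approx> conj z + a"
        by (rule cg_trans[OF conj_add cg_add[OF cg_refl conj_conj]])
      have y: "?y z \<approx> a * ?s + b"
        by (rule cg_trans[OF rep(3)]) (intro cg_add cg_mult cg_refl rep)
      have "conj (?y z) + ?y z \<approx> (conj a * conj ?s + conj b) + (a * ?s + b)"
        by (intro cg_add y cg_trans[OF cg_power[OF y] conj_line])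
      also have "\<dots> \<approx> (conj a * (conj z + a) + conj b) + (a * ?s + b)"
        by (intro cg_add cg_mult cg_refl s')
      also have "\<dots> = ?s * (conj z + a) + (c - z * conj z)"
        by (simp add: c_def algebra_simps)
      also have "\<dots> \<approx> ?s * conj ?s + (c - c)"
        by (intro cg_add cg_mult cg_diff cg_refl cg_sym[OF s'] z)
      also have "\<dots> = ?s * conj ?s" by simp
      also have "\<dots> \<approx> ?x z * conj (?x z)"
        by (intro cg_mult cg_power rep)
      finally have "conj (?y z) + ?y z \<approx> ?x z * conj (?x z)" .
      then show "(?x z, ?y z) \<in> on_secant l"
        by (auto simp: on_secant_def points_def rep l)
    qed
    show "finite (on_secant l)" using finite_subset[OF on_secant_subset finite_points] .
  qed
  finally show ?thesis .
qed

text \<open>At a common point, equal slopes would force equal intercepts, hence equal lines.\<close>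

lemma secant_slopes:
  assumes "l \<in> secants" "l' \<in> secants" "l \<noteq> l'" "u \<in> on_secant l" "u \<in> on_secant l'"
  shows "fst l - fst l' \<notin> I" "fst l * fst u + snd l \<approx> fst l' * fst u + snd l'"
proof -
  have y: "snd u \<approx> fst l * fst u + snd l" "snd u \<approx> fst l' * fst u + snd l'"
    using assms(4,5) by (auto simp: on_secant_def)
  show eq: "fst l * fst u + snd l \<approx> fst l' * fst u + snd l'"
    using cg_trans[OF cg_sym[OF y(1)] y(2)] .
  show "fst l - fst l' \<notin> I"
  proof
    assume a: "fst l - fst l' \<in> I"
    have "snd l - snd l' = (fst l * fst u + snd l) - (fst l' * fst u + snd l') - (fst l - fst l') * fst u"
      by (simp add: algebra_simps)
    also have "\<dots> \<in> I" by (rule diff_mem[OF eq[unfolded cg_def] mult_mem'[OF a]])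
    finally have "fst l = fst l'" "snd l = snd l'"
      using a assms(1,2) F_unique by (auto simp: secants_def cg_def)
    then show False using assms(3) by (simp add: prod_eq_iff)
  qed
qed

lemma on_secant_fst_inj:
  assumes "u \<in> on_secant l" "v \<in> on_secant l" "fst u - fst v \<in> I"
  shows "u = v"
proof -
  have F: "fst u \<in> F" "fst v \<in> F" "snd u \<in> F" "snd v \<in> F"
    using assms(1,2) by (auto simp: on_secant_def points_def)
  then have eq: "fst u = fst v" using assms(3) F_unique by (simp add: cg_def)
  have "snd u \<approx> fst l * fst u + snd l" "snd v \<approx> fst l * fst u + snd l"
    using assms(1,2) eq by (auto simp: on_secant_def)
  then have "snd u \<approx> snd v" using cg_trans cg_sym by blast
  then show ?thesis using F F_unique eq by (simp add: prod_eq_iff)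
qed

lemma secants_meet_once:
  assumes "l \<in> secants" "l' \<in> secants" "l \<noteq> l'"
    and "u \<in> on_secant l" "u \<in> on_secant l'" "v \<in> on_secant l" "v \<in> on_secant l'"
  shows "u = v"
proof (rule on_secant_fst_inj[OF assms(4,6)])
  note u = secant_slopes[OF assms(1-5)] and v = secant_slopes[OF assms(1-3,6,7)]
  have "(fst l - fst l') * (fst u - fst v) =
      ((fst l * fst u + snd l) - (fst l' * fst u + snd l')) - ((fst l * fst v + snd l) - (fst l' * fst v + snd l'))"
    by (simp add: algebra_simps)
  also have "\<dots> \<in> I" by (rule diff_mem[OF u(2)[unfolded cg_def] v(2)[unfolded cg_def]])
  finally show "fst u - fst v \<in> I" using u(1) mult_notin by blast
qed

lemma on_secant_isotropic:
  assumes "u \<in> on_secant l"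
  shows "fst l * fst u + snd l + conj (fst l) * conj (fst u) + conj (snd l) - fst u * conj (fst u) \<in> I"
proof -
  have y: "snd u \<approx> fst l * fst u + snd l" and h: "conj (snd u) + snd u \<approx> fst u * conj (fst u)"
    using assms by (auto simp: on_secant_def points_def)
  have "(conj (fst l) * conj (fst u) + conj (snd l)) + (fst l * fst u + snd l) \<approx> conj (snd u) + snd u"
    by (intro cg_add cg_sym[OF y] cg_sym[OF cg_trans[OF cg_power[OF y] conj_line]])
  also note h
  finally show ?thesis by (simp add: cg_def algebra_simps)
qed

lemma no_onan:
  assumes "l1 \<in> secants" "l2 \<in> secants" "l3 \<in> secants" "l4 \<in> secants"
    and "l1 \<noteq> l4" "l2 \<noteq> l4" "l3 \<noteq> l4" "l2 \<noteq> l3" "l1 \<noteq> l3" "l1 \<noteq> l2"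
    and "A \<in> on_secant l2" "A \<in> on_secant l3" "B \<in> on_secant l1" "B \<in> on_secant l3"
    and "C \<in> on_secant l1" "C \<in> on_secant l2" "D \<in> on_secant l1" "D \<in> on_secant l4"
    and "E \<in> on_secant l2" "E \<in> on_secant l4" "G \<in> on_secant l3" "G \<in> on_secant l4"
    and "A \<noteq> B" "A \<noteq> C" "C \<noteq> D" "A \<noteq> E" "B \<noteq> G"
  shows False
proof (rule no_onan_coordinates)
  show "fst l2 * fst A + snd l2 \<approx> fst l3 * fst A + snd l3"
    "fst l1 * fst B + snd l1 \<approx> fst l3 * fst B + snd l3"
    "fst l1 * fst C + snd l1 \<approx> fst l2 * fst C + snd l2"
    "fst l1 * fst D + snd l1 \<approx> fst l4 * fst D + snd l4"
    "fst l2 * fst E + snd l2 \<approx> fst l4 * fst E + snd l4"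
    "fst l3 * fst G + snd l3 \<approx> fst l4 * fst G + snd l4"
    using assms by (blast intro: secant_slopes(2))+
  show "fst l1 - fst l4 \<notin> I" "fst l2 - fst l4 \<notin> I" "fst l3 - fst l4 \<notin> I" "fst l2 - fst l3 \<notin> I"
    using assms(1-22) by (blast dest: secant_slopes(1))+
  show "fst B - fst A \<notin> I" "fst C - fst A \<notin> I" "fst C - fst D \<notin> I" "fst A - fst E \<notin> I" "fst B - fst G \<notin> I"
    using assms(11-27) by (blast dest: on_secant_fst_inj)+
qed (rule on_secant_isotropic, fact)+

end

section \<open>Random bipartitions\<close>

text \<open>A balanced bipartition of a clique on \<open>x\<close> lines keeps at least
  \<open>x\<^sup>2 / 16\<close> edges. This 16 and the square of the quarter of
  \<open>q * card X\<close> incidences kept later make up the constant 256.\<close>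

definition unbalanced :: "'v set \<Rightarrow> 'v set \<Rightarrow> bool" where
  "unbalanced Y S \<longleftrightarrow> 16 * (card (Y \<inter> S) * card (Y - S)) < (card Y)\<^sup>2"

text \<open>If both parts exceed an eighth of the total, the smaller part \<open>u\<close> and the
  larger part \<open>v\<close> satisfy \<open>u + v < 8 * u\<close> and
  \<open>u + v \<le> 2 * v\<close>; multiplying shows balance.\<close>

lemma unbalancedD:
  assumes "finite Y" "unbalanced Y S"
  shows "8 * card (Y \<inter> S) \<le> card Y \<or> 8 * card (Y - S) \<le> card Y"
proof (rule ccontr)
  assume neg: "\<not> ?thesis"
  let ?a = "card (Y \<inter> S)" and ?b = "card (Y - S)"
  have sum: "card Y = ?a + ?b"
    using card_Int_Diff[OF assms(1)] by simp
  have small: "16 * (u * v) \<ge> (u + v)\<^sup>2" if "u \<le> v" "u + v < 8 * u" for u v :: nat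
  proof -
    have "(u + v)\<^sup>2 \<le> (8 * u) * (2 * v)"
      unfolding power2_eq_square using that by (intro mult_mono) auto
    then show ?thesis by simp
  qed
  have "(?a + ?b)\<^sup>2 \<le> 16 * (?a * ?b)"
  proof (cases "?a \<le> ?b")
    case True
    then show ?thesis using small[of ?a ?b] neg sum by simp
  next
    case False
    then show ?thesis using small[of ?b ?a] neg sum by (simp add: add.commute mult.commute)
  qed
  then show False using assms(2) unfolding unbalanced_def sum by linarith
qed

text \<open>The generating function of a binomial distribution: expanding a product over
  \<open>V\<close>, each element of \<open>Y\<close> contributes a factor \<open>1 + r\<close> and
  each other element a factor 2. It serves the Chernoff bound and, with \<open>Y = V\<close>, the
  sum over all sets of lines.\<close>

lemma sum_Pow_power_card_Int:
  fixes r :: "'a::comm_ring_1"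
  assumes "finite V" "Y \<subseteq> V"
  shows "(\<Sum>S\<in>Pow V. r ^ card (Y \<inter> S)) = (1 + r) ^ card Y * 2 ^ (card V - card Y)"
    and "(\<Sum>S\<in>Pow V. r ^ card (Y - S)) = (1 + r) ^ card Y * 2 ^ (card V - card Y)"
proof -
  let ?f = "\<lambda>i. if i \<in> Y then r else 1"
  have fY: "finite Y" using assms finite_subset by blast
  have prod_f: "prod ?f S = r ^ card (Y \<inter> S)" if "finite S" for S
    using that by (simp add: prod.If_cases Int_commute)
  have "(\<Prod>i\<in>V. ?f i + 1) = (\<Prod>i\<in>V. if i \<in> Y then 1 + r else 2)"
    by (intro prod.cong) auto
  also have "\<dots> = (1 + r) ^ card Y * 2 ^ (card V - card Y)"
    using assms fY by (simp add: prod.If_cases Int_absorb1 card_Diff_subset flip: Diff_eq)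
  finally have val: "(\<Prod>i\<in>V. ?f i + 1) = (1 + r) ^ card Y * 2 ^ (card V - card Y)" .
  have "(\<Prod>i\<in>V. ?f i + 1) = (\<Sum>S\<in>Pow V. prod ?f S)"
    unfolding prod_add[OF assms(1)] by simp
  also have "\<dots> = (\<Sum>S\<in>Pow V. r ^ card (Y \<inter> S))"
    using assms(1) by (intro sum.cong prod_f) (auto intro: finite_subset)
  finally show "(\<Sum>S\<in>Pow V. r ^ card (Y \<inter> S)) = (1 + r) ^ card Y * 2 ^ (card V - card Y)"
    using val by simp
  have "(\<Prod>i\<in>V. 1 + ?f i) = (\<Sum>S\<in>Pow V. prod ?f (V - S))"
    unfolding prod_add[OF assms(1)] by simp
  also have "\<dots> = (\<Sum>S\<in>Pow V. r ^ card (Y \<inter> (V - S)))"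
    using assms(1) by (intro sum.cong prod_f) auto
  also have "\<dots> = (\<Sum>S\<in>Pow V. r ^ card (Y - S))"
    using assms(2) by (intro sum.cong refl arg_cong[of _ _ "\<lambda>S. r ^ card S"]) auto
  finally show "(\<Sum>S\<in>Pow V. r ^ card (Y - S)) = (1 + r) ^ card Y * 2 ^ (card V - card Y)"
    using val by (simp add: add.commute)
qed

text \<open>A Chernoff bound for a uniformly random subset \<open>S\<close> of \<open>V\<close>: unbalanced sets get weight
  \<open>(41/40)^(8 |Y|)\<close>, and the tilt \<open>6/5\<close> makes \<open>(41/40)^8 (6/5) (1 + (5/6)^8) \<le> 2\<close>.\<close>

lemma sum_unbalanced_weights:
  assumes "finite V" "Y \<subseteq> V"
  shows "(\<Sum>S\<in>Pow V. if unbalanced Y S then (41 / 40 :: real) ^ (8 * card Y) else 1) \<le> 3 * 2 ^ card V"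
proof -
  let ?x = "card Y"
  define r :: real where "r = (5 / 6) ^ 8"
  define c :: real where "c = (41 / 40) ^ 8 * (6 / 5)"
  have fY: "finite Y" using assms finite_subset by blast
  have tilt: "(41 / 40 :: real) ^ (8 * ?x) \<le> c ^ ?x * r ^ a" if "8 * a \<le> ?x" for a
  proof -
    have "c ^ ?x * r ^ a = (41 / 40) ^ (8 * ?x) * ((6 / 5) ^ ?x * (5 / 6) ^ (8 * a))"
      unfolding c_def r_def power_mult power_mult_distrib by (simp only: mult.assoc)
    also have "(6 / 5 :: real) ^ ?x * (5 / 6) ^ (8 * a) = (6 / 5) ^ (?x - 8 * a) * ((6 / 5) * (5 / 6)) ^ (8 * a)"
      unfolding power_mult_distrib using that by (simp flip: power_add mult.assoc)
    also have "(41 / 40 :: real) ^ (8 * ?x) * \<dots> \<ge> (41 / 40) ^ (8 * ?x) * 1"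
      by (intro mult_left_mono) auto
    finally show ?thesis by simp
  qed
  have r0: "0 \<le> r" and c0: "0 \<le> c" by (simp_all add: r_def c_def)
  have le: "(if unbalanced Y S then (41 / 40 :: real) ^ (8 * ?x) else 1) \<le>
      1 + c ^ ?x * r ^ card (Y \<inter> S) + c ^ ?x * r ^ card (Y - S)" for S
  proof -
    have "0 \<le> c ^ ?x * r ^ card (Y \<inter> S)" "0 \<le> c ^ ?x * r ^ card (Y - S)"
      using r0 c0 by auto
    then show ?thesis
      using unbalancedD[OF fY, of S] tilt[of "card (Y \<inter> S)"] tilt[of "card (Y - S)"]
      by (auto split: if_splits)
  qed
  have "c * (1 + r) \<le> 2" by (simp add: c_def r_def power_numeral_reduce power_divide)
  then have "(c * (1 + r)) ^ ?x * 2 ^ (card V - ?x) \<le> 2 ^ ?x * 2 ^ (card V - ?x)"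
    using r0 c0 by (intro mult_right_mono power_mono) auto
  also have "\<dots> = 2 ^ card V"
    using card_mono[OF assms] by (simp flip: power_add)
  finally have bound: "c ^ ?x * ((1 + r) ^ ?x * 2 ^ (card V - ?x)) \<le> 2 ^ card V"
    by (simp add: power_mult_distrib mult.assoc)
  have "(\<Sum>S\<in>Pow V. if unbalanced Y S then (41 / 40 :: real) ^ (8 * ?x) else 1) \<le>
      (\<Sum>S\<in>Pow V. 1 + c ^ ?x * r ^ card (Y \<inter> S) + c ^ ?x * r ^ card (Y - S))"
    by (intro sum_mono le)
  also have "\<dots> = 2 ^ card V + c ^ ?x * ((1 + r) ^ ?x * 2 ^ (card V - ?x))
      + c ^ ?x * ((1 + r) ^ ?x * 2 ^ (card V - ?x))"
    using assms by (simp add: sum.distrib card_Pow sum_Pow_power_card_Int flip: sum_distrib_left)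
  finally show ?thesis using bound by linarith
qed

section \<open>Graphs from bipartitions of the cliques of a linear space\<close>

locale onan_free_linear_space =
  fixes V :: "'v set" and Pts :: "'p set" and f :: "'v \<Rightarrow> 'p set"
  assumes finite_V: "finite V" and finite_Pts: "finite Pts"
    and f_subset: "i \<in> V \<Longrightarrow> f i \<subseteq> Pts"
    and meet_once: "\<lbrakk>i \<in> V; j \<in> V; i \<noteq> j; P \<in> f i; P \<in> f j; Q \<in> f i; Q \<in> f j\<rbrakk> \<Longrightarrow> P = Q"
    and onan_free: "\<lbrakk>i \<in> V; j \<in> V; k \<in> V; l \<in> V; distinct [i, j, k, l];
      A \<in> f j; A \<in> f k; B \<in> f i; B \<in> f k; C \<in> f i; C \<in> f j;
      D \<in> f i; D \<in> f l; E \<in> f j; E \<in> f l; G \<in> f k; G \<in> f l;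
      A \<noteq> B; A \<noteq> C; C \<noteq> D; A \<noteq> E; B \<noteq> G\<rbrakk> \<Longrightarrow> False"
begin

text \<open>\<open>w P\<close> is one side of the bipartition of the clique of lines through \<open>P\<close>.\<close>

definition edges :: "('p \<Rightarrow> 'v set) \<Rightarrow> 'v set set" where
  "edges w = {{i, j} |i j P. i \<in> V \<and> j \<in> V \<and> P \<in> f i \<and> P \<in> f j \<and> i \<in> w P \<and> j \<notin> w P}"

definition through :: "'v set \<Rightarrow> 'p \<Rightarrow> 'v set" where
  "through X P = {i \<in> X. P \<in> f i}"

lemma simple_graph_edges: "simple_graph V (edges w)"
  unfolding simple_graph_def edges_def using finite_V by (auto simp: card_2_iff)

lemma edgeE:
  assumes "{i, j} \<in> edges w"
  obtains P where "P \<in> f i" "P \<in> f j" "(i \<in> w P) \<noteq> (j \<in> w P)"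
  using assms unfolding edges_def by (auto simp: doubleton_eq_iff)

text \<open>Two lines share only one point, so all three edges arise from the bipartition at
  \<open>P\<close>, and a bipartite graph has no triangle.\<close>

lemma edges_triangle:
  assumes V: "i \<in> V" "j \<in> V" "k \<in> V" and d: "i \<noteq> j" "i \<noteq> k" "j \<noteq> k"
    and e: "{i, j} \<in> edges w" "{i, k} \<in> edges w" "{j, k} \<in> edges w"
    and P: "P \<in> f i" "P \<in> f j" "P \<in> f k"
  shows False
proof -
  obtain A where A: "A \<in> f i" "A \<in> f j" "(i \<in> w A) \<noteq> (j \<in> w A)" using e(1) by (rule edgeE)
  obtain B where B: "B \<in> f i" "B \<in> f k" "(i \<in> w B) \<noteq> (k \<in> w B)" using e(2) by (rule edgeE)
  obtain C where C: "C \<in> f j" "C \<in> f k" "(j \<in> w C) \<noteq> (k \<in> w C)" using e(3) by (rule edgeE)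
  have "A = P" by (rule meet_once[OF V(1,2) d(1) A(1,2) P(1,2)])
  moreover have "B = P" by (rule meet_once[OF V(1,3) d(2) B(1,2) P(1,3)])
  moreover have "C = P" by (rule meet_once[OF V(2,3) d(3) C(1,2) P(2,3)])
  ultimately show False using A B C by blast
qed

text \<open>Each of the six edges provides a meeting point. A coincidence between points on a common
  line would make three of the lines concurrent, against \<open>edges_triangle\<close>; without one,
  the four lines form an O'Nan configuration.\<close>

lemma K4_free_edges: "K4_free V (edges w)"
  unfolding K4_free_def
proof safe
  fix i j k l
  assume V: "i \<in> V" "j \<in> V" "k \<in> V" "l \<in> V" and d: "distinct [i, j, k, l]"
    and e: "{i, j} \<in> edges w" "{i, k} \<in> edges w" "{i, l} \<in> edges w"
      "{j, k} \<in> edges w" "{j, l} \<in> edges w" "{k, l} \<in> edges w"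
  obtain C where C: "C \<in> f i" "C \<in> f j" using e(1) by (rule edgeE)
  obtain B where B: "B \<in> f i" "B \<in> f k" using e(2) by (rule edgeE)
  obtain D where D: "D \<in> f i" "D \<in> f l" using e(3) by (rule edgeE)
  obtain A where A: "A \<in> f j" "A \<in> f k" using e(4) by (rule edgeE)
  obtain E where E: "E \<in> f j" "E \<in> f l" using e(5) by (rule edgeE)
  obtain G where G: "G \<in> f k" "G \<in> f l" using e(6) by (rule edgeE)
  have neq: "i \<noteq> j" "i \<noteq> k" "i \<noteq> l" "j \<noteq> k" "j \<noteq> l" "k \<noteq> l" using d by auto
  have "A \<noteq> B" "A \<noteq> C"
    using edges_triangle[OF V(1,2,3) neq(1,2,4) e(1,2,4)] A B C by auto
  moreover have "C \<noteq> D"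
    using edges_triangle[OF V(1,2,4) neq(1,3,5) e(1,3,5)] C D by auto
  moreover have "A \<noteq> E"
    using edges_triangle[OF V(2,3,4) neq(4,5,6) e(4,5,6)] A E by auto
  moreover have "B \<noteq> G"
    using edges_triangle[OF V(1,3,4) neq(2,3,6) e(2,3,6)] B G by auto
  ultimately show False
    using onan_free[OF V d A B C D E G] by blast
qed

text \<open>Edges counted at different points are different, since an edge determines the common
  point of its two lines, and its orientation is determined by \<open>w\<close> at that
  point.\<close>

lemma induced_edges_ge:
  assumes "X \<subseteq> V"
  shows "(\<Sum>P\<in>Pts. card (through X P \<inter> w P) * card (through X P - w P)) \<le> induced_edges (edges w) X"
proof -
  have fX: "finite X" using assms finite_V finite_subset by blast
  then have fin: "finite (through X P \<inter> w P)" "finite (through X P - w P)" for P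
    by (auto simp: through_def)
  let ?T = "SIGMA P:Pts. (through X P \<inter> w P) \<times> (through X P - w P)"
  let ?h = "\<lambda>(P::'p, i, j). {i, j}"
  have "inj_on ?h ?T"
  proof (rule inj_onI)
    fix s t assume s: "s \<in> ?T" and t: "t \<in> ?T" and eq: "?h s = ?h t"
    obtain P i j P' i' j' where st: "s = (P, i, j)" "t = (P', i', j')" by (cases s, cases t) auto
    have i: "i \<in> through X P" "i \<in> w P" and j: "j \<in> through X P" "j \<notin> w P"
      and i': "i' \<in> through X P'" "i' \<in> w P'" and j': "j' \<in> through X P'" "j' \<notin> w P'"
      using s t by (auto simp: st)
    have swap: "i = i' \<and> j = j' \<or> i = j' \<and> j = i'" using eq by (auto simp: st doubleton_eq_iff)
    then have "P \<in> f i" "P \<in> f j" "P' \<in> f i" "P' \<in> f j" "i \<in> V" "j \<in> V" "i \<noteq> j"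
      using i j i' j' assms by (auto simp: through_def)
    then have "P = P'" using meet_once by blast
    then show "s = t" using swap i(2) j(2) i'(2) j'(2) by (auto simp: st)
  qed
  moreover have "?h ` ?T \<subseteq> {e \<in> edges w. e \<subseteq> X}"
  proof
    fix e assume "e \<in> ?h ` ?T"
    then obtain P i j where e: "e = {i, j}"
      and *: "i \<in> through X P" "i \<in> w P" "j \<in> through X P" "j \<notin> w P" by auto
    then have "i \<in> V" "j \<in> V" "P \<in> f i" "P \<in> f j" and X: "e \<subseteq> X"
      using assms by (auto simp: through_def)
    then have "e \<in> edges w" unfolding edges_def using e * by blast
    then show "e \<in> {e \<in> edges w. e \<subseteq> X}" using X by simp
  qed
  moreover have "finite {e \<in> edges w. e \<subseteq> X}"
    using fX by (auto intro: rev_finite_subset[of "Pow X"])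
  ultimately have "card ?T \<le> induced_edges (edges w) X"
    unfolding induced_edges_def by (rule card_inj_on_le)
  then show ?thesis
    using finite_Pts fin by (simp add: card_SigmaI card_cartesian_product)
qed

definition bad_incidences :: "'v set \<Rightarrow> ('p \<Rightarrow> 'v set) \<Rightarrow> nat" where
  "bad_incidences X w = (\<Sum>P\<in>{P \<in> Pts. unbalanced (through X P) (w P)}. card (through X P))"

text \<open>Of at least \<open>q * card X / 2\<close> incidences at most
  \<open>q * card X / 4\<close> are bad, so \<open>q * card X / 4\<close> remain at balanced points,
  of which there are at most \<open>q ^ 3\<close>. Convexity bounds the sum of squares there, and a
  sixteenth of it is the claimed number of edges.\<close>

lemma induced_edges_lower_bound:
  assumes "X \<subseteq> V" "card Pts \<le> q ^ 3" "q > 0"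
    and "q * card X \<le> 2 * (\<Sum>P\<in>Pts. card (through X P))"
    and "4 * bad_incidences X w \<le> q * card X"
  shows "real (induced_edges (edges w) X) \<ge> real (card X)^2 / (256 * real q)"
proof -
  let ?G = "{P \<in> Pts. \<not> unbalanced (through X P) (w P)}"
  let ?x = "\<lambda>P. real (card (through X P))"
  define S where "S = real q * real (card X) / 4"
  \<comment> \<open>The mean of \<open>S\<close> incidences over \<open>q ^ 3\<close> points.
    Summing the tangent \<open>2 * t * x - t\<^sup>2\<close> of the square at this mean replaces
    Cauchy-Schwarz, and having fewer than \<open>q ^ 3\<close> points only helps.\<close>
  define t where "t = S / real q ^ 3"
  have "(\<Sum>P\<in>Pts. card (through X P)) = bad_incidences X w + (\<Sum>P\<in>?G. card (through X P))"
    unfolding bad_incidences_def using finite_Pts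
    by (subst sum.union_disjoint[symmetric]) (auto intro!: sum.cong)
  then have "q * card X \<le> 4 * (\<Sum>P\<in>?G. card (through X P))" using assms(4,5) by linarith
  then have "real (q * card X) \<le> real (4 * (\<Sum>P\<in>?G. card (through X P)))" by (simp only: of_nat_le_iff)
  then have S: "S \<le> (\<Sum>P\<in>?G. ?x P)" by (simp add: S_def)
  have t0: "t \<ge> 0" by (simp add: t_def S_def)
  have "card ?G \<le> card Pts" using finite_Pts by (intro card_mono) auto
  then have "real (card ?G) \<le> real (q ^ 3)" using assms(2) by (simp only: of_nat_le_iff)
  then have G: "real (card ?G) \<le> real q ^ 3" by simp
  have "S\<^sup>2 / real q ^ 3 = 2 * t * S - t\<^sup>2 * real q ^ 3"
    using assms(3) by (simp add: t_def field_simps power2_eq_square)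
  also have "\<dots> \<le> 2 * t * (\<Sum>P\<in>?G. ?x P) - t\<^sup>2 * real (card ?G)"
    using S t0 G by (intro diff_mono mult_left_mono) auto
  also have "\<dots> = (\<Sum>P\<in>?G. 2 * t * ?x P - t\<^sup>2)"
    by (simp add: sum_subtractf sum_distrib_left mult.commute)
  also have "\<dots> \<le> (\<Sum>P\<in>?G. (?x P)\<^sup>2)"
  proof (rule sum_mono)
    fix P show "2 * t * ?x P - t\<^sup>2 \<le> (?x P)\<^sup>2"
      using zero_le_power2[of "?x P - t"] by (simp add: power2_eq_square algebra_simps)
  qed
  also have "\<dots> \<le> (\<Sum>P\<in>?G. 16 * real (card (through X P \<inter> w P) * card (through X P - w P)))"
  proof (rule sum_mono)
    fix P assume "P \<in> ?G"
    then have "(card (through X P))\<^sup>2 \<le> 16 * (card (through X P \<inter> w P) * card (through X P - w P))"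
      by (simp add: unbalanced_def)
    then have "real ((card (through X P))\<^sup>2) \<le> real (16 * (card (through X P \<inter> w P) * card (through X P - w P)))"
      by (simp only: of_nat_le_iff)
    then show "(?x P)\<^sup>2 \<le> 16 * real (card (through X P \<inter> w P) * card (through X P - w P))" by simp
  qed
  also have "\<dots> \<le> (\<Sum>P\<in>Pts. 16 * real (card (through X P \<inter> w P) * card (through X P - w P)))"
    using finite_Pts by (intro sum_mono2) auto
  also have "\<dots> = 16 * real (\<Sum>P\<in>Pts. card (through X P \<inter> w P) * card (through X P - w P))"
    by (simp add: sum_distrib_left)
  also have "\<dots> \<le> 16 * real (induced_edges (edges w) X)"
    using induced_edges_ge[OF assms(1)] by (simp only: of_nat_le_iff mult_le_cancel_left_pos)
  finally have "S\<^sup>2 / real q ^ 3 \<le> 16 * real (induced_edges (edges w) X)" .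
  moreover have "S\<^sup>2 / real q ^ 3 = 16 * (real (card X)^2 / (256 * real q))"
    using assms(3) by (simp add: S_def field_simps power2_eq_square power3_eq_cube)
  ultimately show ?thesis by simp
qed

section \<open>The union bound over sets of lines\<close>

abbreviation colourings :: "('p \<Rightarrow> 'v set) set" where
  "colourings \<equiv> Pts \<rightarrow>\<^sub>E Pow V"

text \<open>Markov's inequality for an exponential weight: a bad colouring has total weight at least
  \<open>(41 / 40) ^ (2 * (q * card X))\<close>. The sum of the weights over all colourings factors
  over the points, since the bipartitions are chosen independently.\<close>

lemma card_bad_colourings:
  assumes "X \<subseteq> V"
  shows "real (card {w \<in> colourings. q * card X < 4 * bad_incidences X w}) * (41 / 40) ^ (2 * (q * card X))
    \<le> 3 ^ card Pts * real (card colourings)"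
proof -
  let ?B = "{w \<in> colourings. q * card X < 4 * bad_incidences X w}"
  let ?wt = "\<lambda>P S. if unbalanced (through X P) S then (41 / 40 :: real) ^ (8 * card (through X P)) else 1"
  have fin: "finite colourings" using finite_Pts finite_V by (intro finite_PiE) auto
  have "real (card ?B) * (41 / 40) ^ (2 * (q * card X)) = (\<Sum>w\<in>?B. (41 / 40) ^ (2 * (q * card X)))"
    by simp
  also have "\<dots> \<le> (\<Sum>w\<in>?B. \<Prod>P\<in>Pts. ?wt P (w P))"
  proof (rule sum_mono)
    fix w assume w: "w \<in> ?B"
    have "(\<Prod>P\<in>Pts. ?wt P (w P)) =
        (\<Prod>P\<in>{P \<in> Pts. unbalanced (through X P) (w P)}. (41 / 40) ^ (8 * card (through X P)))"
      using finite_Pts by (simp add: prod.If_cases Int_def)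
    also have "\<dots> = (41 / 40) ^ (8 * bad_incidences X w)"
      unfolding bad_incidences_def by (simp add: power_sum sum_distrib_left)
    finally show "(41 / 40) ^ (2 * (q * card X)) \<le> (\<Prod>P\<in>Pts. ?wt P (w P))"
      using w by (auto intro!: power_increasing)
  qed
  also have "\<dots> \<le> (\<Sum>w\<in>colourings. \<Prod>P\<in>Pts. ?wt P (w P))"
    using fin by (intro sum_mono2) (auto intro!: prod_nonneg)
  also have "\<dots> = (\<Prod>P\<in>Pts. \<Sum>S\<in>Pow V. ?wt P S)"
    using finite_Pts finite_V by (subst prod_sum_PiE) auto
  also have "\<dots> \<le> (\<Prod>P\<in>Pts. 3 * 2 ^ card V)"
    using assms by (intro prod_mono conjI sum_nonneg sum_unbalanced_weights finite_V)
      (auto simp: through_def)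
  also have "\<dots> = 3 ^ card Pts * real (card colourings)"
    using finite_Pts finite_V by (simp add: card_PiE card_Pow power_mult_distrib)
  finally show ?thesis .
qed

text \<open>Half of the decay in \<open>card_bad_colourings\<close> is bounded by means of
  \<open>m \<le> card X\<close>. The other half is kept as \<open>((40 / 41) ^ q) ^ card X\<close>
  and summed over all subsets, giving the factor
  \<open>(1 + (40 / 41) ^ q) ^ card V\<close>.\<close>

lemma exists_good_colouring:
  assumes "3 ^ card Pts * (1 + (40 / 41) ^ q) ^ card V < (41 / 40 :: real) ^ (q * m)"
  obtains w where "\<And>X. X \<subseteq> V \<Longrightarrow> m \<le> card X \<Longrightarrow> 4 * bad_incidences X w \<le> q * card X"
proof -
  let ?B = "\<lambda>X. {w \<in> colourings. q * card X < 4 * bad_incidences X w}"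
  let ?L = "{X \<in> Pow V. m \<le> card X}"
  let ?N = "real (card colourings)"
  have fin: "finite colourings" using finite_Pts finite_V by (intro finite_PiE) auto
  have pos: "?N > 0"
    using finite_Pts finite_V by (simp add: card_PiE card_Pow)
  have inv: "(40 / 41 :: real) ^ i * (41 / 40) ^ i = 1" for i
    unfolding power_mult_distrib[symmetric] by simp
  have B: "real (card (?B X)) \<le> 3 ^ card Pts * ?N * (40 / 41) ^ (q * m) * ((40 / 41) ^ q) ^ card X"
    if X: "X \<in> ?L" for X
  proof -
    let ?e = "q * card X"
    have "real (card (?B X)) = real (card (?B X)) * ((40 / 41) ^ (2 * ?e) * (41 / 40) ^ (2 * ?e))"
      unfolding inv by simp
    also have "\<dots> = real (card (?B X)) * (41 / 40) ^ (2 * ?e) * (40 / 41) ^ (2 * ?e)"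
      by (simp only: mult_ac)
    also have "\<dots> \<le> 3 ^ card Pts * ?N * (40 / 41) ^ (2 * ?e)"
      using X by (intro mult_right_mono card_bad_colourings) auto
    also have "(40 / 41 :: real) ^ (2 * ?e) = (40 / 41) ^ ?e * ((40 / 41) ^ q) ^ card X"
      by (simp add: mult_2 power_add power_mult)
    also have "3 ^ card Pts * ?N * \<dots> \<le> 3 ^ card Pts * ?N * ((40 / 41) ^ (q * m) * ((40 / 41) ^ q) ^ card X)"
      using X by (intro mult_left_mono mult_right_mono power_decreasing) auto
    finally show ?thesis by (simp only: mult.assoc)
  qed
  have "card (\<Union>X\<in>?L. ?B X) \<le> (\<Sum>X\<in>?L. card (?B X))"
    using finite_V by (intro card_UN_le) auto
  then have "real (card (\<Union>X\<in>?L. ?B X)) \<le> (\<Sum>X\<in>?L. real (card (?B X)))"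
    by (simp only: of_nat_sum[symmetric] of_nat_le_iff)
  also have "\<dots> \<le> (\<Sum>X\<in>?L. 3 ^ card Pts * ?N * (40 / 41) ^ (q * m) * ((40 / 41) ^ q) ^ card X)"
    by (intro sum_mono B)
  also have "\<dots> \<le> (\<Sum>X\<in>Pow V. 3 ^ card Pts * ?N * (40 / 41) ^ (q * m) * ((40 / 41) ^ q) ^ card (V \<inter> X))"
  proof -
    \<comment> \<open>Writing \<open>V \<inter> X\<close> for \<open>X\<close> matches the
      generating function with \<open>Y = V\<close>; the sum can then be enlarged to all
      subsets.\<close>
    have "(\<Sum>X\<in>?L. 3 ^ card Pts * ?N * (40 / 41) ^ (q * m) * ((40 / 41) ^ q) ^ card X) =
        (\<Sum>X\<in>?L. 3 ^ card Pts * ?N * (40 / 41) ^ (q * m) * ((40 / 41) ^ q) ^ card (V \<inter> X))"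
      by (intro sum.cong refl) (simp add: Int_absorb1)
    also have "\<dots> \<le> (\<Sum>X\<in>Pow V. 3 ^ card Pts * ?N * (40 / 41) ^ (q * m) * ((40 / 41) ^ q) ^ card (V \<inter> X))"
      using finite_V by (intro sum_mono2) auto
    finally show ?thesis .
  qed
  also have "\<dots> = 3 ^ card Pts * ?N * (40 / 41) ^ (q * m) * (1 + (40 / 41) ^ q) ^ card V"
    using sum_Pow_power_card_Int(1)[OF finite_V subset_refl, of "(40 / 41 :: real) ^ q"]
    unfolding sum_distrib_left[symmetric] by (simp only: Int_absorb1 Int_absorb2 mult_1_right power_0 diff_self_eq_0)
  also have "\<dots> = (3 ^ card Pts * (1 + (40 / 41) ^ q) ^ card V) * ((40 / 41) ^ (q * m) * ?N)"
    by (simp only: mult_ac)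
  also have "\<dots> < (41 / 40) ^ (q * m) * ((40 / 41) ^ (q * m) * ?N)"
    using pos by (intro mult_strict_right_mono assms) auto
  also have "\<dots> = ((40 / 41) ^ (q * m) * (41 / 40) ^ (q * m)) * ?N"
    by (simp only: mult_ac)
  also have "\<dots> = ?N" unfolding inv by simp
  finally have less: "card (\<Union>X\<in>?L. ?B X) < card colourings" by (simp only: of_nat_less_iff)
  have "finite (\<Union>X\<in>?L. ?B X)" using fin finite_V by auto
  then have "\<not> colourings \<subseteq> (\<Union>X\<in>?L. ?B X)"
    using less card_mono[of "\<Union>X\<in>?L. ?B X" colourings] by linarith
  then obtain w where w: "w \<in> colourings" "w \<notin> (\<Union>X\<in>?L. ?B X)" by (auto simp only: subset_eq)
  have "4 * bad_incidences X w \<le> q * card X" if "X \<subseteq> V" "m \<le> card X" for X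
  proof (rule ccontr)
    assume "\<not> ?thesis"
    then have "w \<in> ?B X" using w(1) by (simp add: not_le)
    then show False using w(2) that by blast
  qed
  then show ?thesis by (rule that)
qed

lemma sum_card_through:
  assumes "X \<subseteq> V"
  shows "(\<Sum>P\<in>Pts. card (through X P)) = (\<Sum>i\<in>X. card (f i))"
proof -
  have fX: "finite X" using assms finite_V finite_subset by blast
  have "(\<Sum>P\<in>Pts. card (through X P)) = (\<Sum>P\<in>Pts. \<Sum>i\<in>X. if P \<in> f i then 1 else 0)"
    unfolding through_def using fX by (simp flip: sum.inter_filter)
  also have "\<dots> = (\<Sum>i\<in>X. \<Sum>P\<in>Pts. if P \<in> f i then 1 else 0)" by (rule sum.swap)
  also have "\<dots> = (\<Sum>i\<in>X. card (f i))"
  proof (rule sum.cong[OF refl])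
    fix i assume "i \<in> X"
    then have "{P \<in> Pts. P \<in> f i} = f i" using assms f_subset by blast
    then show "(\<Sum>P\<in>Pts. if P \<in> f i then 1 else 0) = card (f i)"
      using finite_Pts by (simp flip: sum.inter_filter)
  qed
  finally show ?thesis .
qed

end

text \<open>With \<open>M = q ^ 3\<close>, Bernoulli gives
  \<open>(40 / 41) ^ q \<le> 40 / q\<close>, so the second factor is at most
  \<open>exp (40 * M)\<close> and the left side at most \<open>3 ^ (41 * M) < 2 ^ (82 * M)\<close>.
  Bernoulli also gives \<open>2 \<le> (41 / 40) ^ 40\<close>, and the resulting exponent
  \<open>3280 * M\<close> is below \<open>2 ^ 24 * M\<close>.\<close>

lemma union_bound_constants:
  fixes q N n :: nat
  assumes "q \<ge> 1" "N \<le> q ^ 3" "n \<le> q ^ 4"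
  shows "3 ^ N * (1 + (40 / 41) ^ q) ^ n < (41 / 40 :: real) ^ (q * (2 ^ 24 * q\<^sup>2))"
proof -
  let ?M = "q ^ 3"
  have M: "?M \<ge> 1" using assms(1) by simp
  have bern: "1 + real k * (1 / 40) \<le> (41 / 40) ^ k" for k
    using Bernoulli_inequality[of "1 / 40" k] by simp
  have "(40 / 41 :: real) ^ q = 1 / (41 / 40) ^ q" by (simp add: power_divide)
  also have "\<dots> \<le> 1 / (real q / 40)"
    using bern[of q] assms(1) by (intro divide_left_mono) auto
  finally have small: "(40 / 41 :: real) ^ q \<le> 40 / real q" by simp
  have "(1 + (40 / 41 :: real) ^ q) ^ n \<le> exp (40 / real q) ^ n"
    using small exp_ge_add_one_self[of "40 / real q"] by (intro power_mono) (linarith, simp)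
  also have "\<dots> \<le> exp (40 / real q) ^ (q ^ 4)"
    using assms(3) by (intro power_increasing) auto
  also have "\<dots> = exp (real (q ^ 4) * (40 / real q))"
    by (rule exp_of_nat_mult[symmetric])
  also have "real (q ^ 4) * (40 / real q) = real (40 * ?M) * 1"
    using assms(1) by (simp add: field_simps power_numeral_reduce)
  also have "exp \<dots> = exp 1 ^ (40 * ?M)" by (rule exp_of_nat_mult)
  also have "\<dots> \<le> 3 ^ (40 * ?M)" by (intro power_mono exp_le) simp
  finally have "3 ^ N * (1 + (40 / 41) ^ q) ^ n \<le> (3::real) ^ ?M * 3 ^ (40 * ?M)"
    using assms(2) by (intro mult_mono power_increasing) auto
  also have "\<dots> = 3 ^ (41 * ?M)" by (simp flip: power_add)
  also have "(3::real) ^ (41 * ?M) < 4 ^ (41 * ?M)" using assms(1) by (intro power_strict_mono) auto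
  also have "(4::real) ^ (41 * ?M) = 2 ^ (82 * ?M)"
    using power_mult[of "2::real" 2 "41 * ?M"] by simp
  also have "\<dots> \<le> ((41 / 40) ^ 40) ^ (82 * ?M)"
    using bern[of 40] by (intro power_mono) auto
  also have "\<dots> = (41 / 40) ^ (40 * (82 * ?M))" by (simp only: power_mult)
  also have "\<dots> \<le> (41 / 40) ^ (q * (2 ^ 24 * q\<^sup>2))"
    by (intro power_increasing) (simp_all add: power2_eq_square power3_eq_cube)
  finally show ?thesis .
qed

section \<open>The graph\<close>

theorem mainTheorem9:
  fixes q :: nat
  assumes "prime_power q" and "q \<ge> 2 ^ 40"
  shows "\<exists>(V :: nat set) (E :: nat set set).
           simple_graph V E \<and> K4_free V E \<and>
           card V = q^2 * (q^2 - q + 1) \<and>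
           (\<forall>X \<subseteq> V. card X \<ge> 2^24 * q^2 \<longrightarrow>
              real (induced_edges E X) \<ge> real (card X)^2 / (256 * real q))"
proof -
  have q2: "q \<ge> 2" using assms(2) by simp
  obtain p k where p: "prime p" "k \<ge> 1" "q = p ^ k"
    using assms(1) unfolding prime_power_def by blast
  \<comment> \<open>The exponent is doubled because the unital lives over the field of order
    \<open>q\<^sup>2 = p ^ (2 * k)\<close>.\<close>
  have "2 * k \<ge> 1" using p(2) by simp
  from exists_cyclic_residue_field[OF p(1) this]
  obtain I :: "int poly set" and g where I: "prime_ideal I" "of_nat p \<in> I"
    and ord: "\<And>i. g ^ i - 1 \<in> I \<longleftrightarrow> (p ^ (2 * k) - 1) dvd i"
    and cover: "\<And>f. f \<in> I \<or> (\<exists>i<p ^ (2 * k) - 1. f - g ^ i \<in> I)"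
    by blast
  have pq: "p ^ (2 * k) = q\<^sup>2" unfolding p(3) by (simp add: power_mult[symmetric] mult.commute)
  interpret prime_ideal I by (rule I(1))
  interpret H: hermitian_residue_field I g p k q
    by unfold_locales (fact p(1) I(2) p(3) q2 ord[unfolded pq] cover[unfolded pq])+
  define m where "m = q ^ 4 - q ^ 3"
  define n where "n = q\<^sup>2 * (q\<^sup>2 - q + 1)"
  have n: "n = m + q\<^sup>2"
    by (simp add: n_def m_def algebra_simps power2_eq_square power3_eq_cube power4_eq_xxxx)
  have m_le: "n \<le> q ^ 4"
  proof -
    have "q\<^sup>2 - q + 1 \<le> q\<^sup>2" using q2 by (simp add: power2_eq_square Suc_leI)
    then have "q\<^sup>2 * (q\<^sup>2 - q + 1) \<le> q\<^sup>2 * q\<^sup>2" by (rule mult_le_mono2)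
    then show ?thesis unfolding n_def by (simp flip: power_add)
  qed
  have "m \<le> card H.secants" unfolding m_def by (rule H.card_secants)
  \<comment> \<open>The number of non-tangent lines is bounded only from below, so exactly
    \<open>m\<close> of them are selected.\<close>
  then obtain S where S: "S \<subseteq> H.secants" "card S = m" "finite S"
    by (metis obtain_subset_with_card_n)
  obtain e where e: "bij_betw e {0..<m} S"
    using ex_bij_betw_nat_finite[OF S(3)] S(2) by blast
  have e_sec: "e i \<in> H.secants" if "i < m" for i
    using e that S(1) by (auto simp: bij_betw_def)
  have e_inj: "e i \<noteq> e j" if "i < m" "j < m" "i \<noteq> j" for i j
    using e that by (auto simp: bij_betw_def inj_on_def)
  \<comment> \<open>The last \<open>q\<^sup>2\<close> indices receive no points and become isolated
    vertices, which brings the number of vertices to \<open>n\<close>.\<close>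
  define f where "f i = (if i < m then H.on_secant (e i) else {})" for i :: nat
  have f_mem: "i < m \<and> P \<in> H.on_secant (e i)" if "P \<in> f i" for P i
    using that by (simp add: f_def split: if_splits)
  interpret L: onan_free_linear_space "{..<n}" H.points f
  proof
    show "finite H.points" by (rule H.finite_points)
    show "f i \<subseteq> H.points" for i using H.on_secant_subset by (simp add: f_def)
    show "P = Q" if "i \<noteq> j" "P \<in> f i" "P \<in> f j" "Q \<in> f i" "Q \<in> f j" for i j P Q
      using H.secants_meet_once[of "e i" "e j" P Q] e_sec e_inj f_mem that by blast
    show False if d: "distinct [i, j, k, l]" and A: "A \<in> f j" "A \<in> f k" and B: "B \<in> f i" "B \<in> f k"
      and C: "C \<in> f i" "C \<in> f j" and D: "D \<in> f i" "D \<in> f l" and E: "E \<in> f j" "E \<in> f l"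
      and G: "G \<in> f k" "G \<in> f l" and neq: "A \<noteq> B" "A \<noteq> C" "C \<noteq> D" "A \<noteq> E" "B \<noteq> G"
      for i j k l A B C D E G
    proof -
      note mem = A B C D E G
      have lt: "i < m" "j < m" "k < m" "l < m" using mem f_mem by blast+
      have ne: "e i \<noteq> e l" "e j \<noteq> e l" "e k \<noteq> e l" "e j \<noteq> e k" "e i \<noteq> e k" "e i \<noteq> e j"
        using d lt by (simp_all add: e_inj)
      show False
        by (rule H.no_onan[OF e_sec[OF lt(1)] e_sec[OF lt(2)] e_sec[OF lt(3)] e_sec[OF lt(4)] ne
              mem[THEN f_mem, THEN conjunct2] neq])
    qed
  qed simp
  have "3 ^ card H.points * (1 + (40 / 41) ^ q) ^ card {..<n} < (41 / 40 :: real) ^ (q * (2 ^ 24 * q\<^sup>2))"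
    using q2 H.card_points m_le by (intro union_bound_constants) auto
  then obtain w where w: "\<And>X. X \<subseteq> {..<n} \<Longrightarrow> 2 ^ 24 * q\<^sup>2 \<le> card X \<Longrightarrow> 4 * L.bad_incidences X w \<le> q * card X"
    by (rule L.exists_good_colouring) blast
  have "real (induced_edges (L.edges w) X) \<ge> real (card X)^2 / (256 * real q)"
    if X: "X \<subseteq> {..<n}" "2 ^ 24 * q\<^sup>2 \<le> card X" for X
  proof (rule L.induced_edges_lower_bound[OF X(1) H.card_points])
    show "0 < q" using q2 by simp
    show "4 * L.bad_incidences X w \<le> q * card X" by (rule w[OF X])
    have fX: "finite X" using X(1) finite_subset by blast
    \<comment> \<open>At most \<open>q\<^sup>2\<close> elements of \<open>X\<close> are isolated and
      \<open>card X\<close> is at least twice that, so at least half of \<open>X\<close> are lines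
      with \<open>q + 1\<close> or more points each.\<close>
    let ?Y = "X \<inter> {..<m}"
    have "card (X - ?Y) \<le> card {m..<n}"
      using X(1) by (intro card_mono) auto
    then have "card (X - ?Y) \<le> q\<^sup>2" by (simp add: n)
    moreover have "card X = card ?Y + card (X - ?Y)"
      using card_Int_Diff[OF fX, of "{..<m}"] by (simp add: Diff_Int)
    moreover have "2 * q\<^sup>2 \<le> card X"
      using X(2) by (rule order_trans[rotated]) (intro mult_le_mono1, simp)
    ultimately have "card X \<le> 2 * card ?Y" by linarith
    then have "q * card X \<le> 2 * (card ?Y * (q + 1))"
      using mult_le_mono[of "card X" "2 * card ?Y" q "q + 1"] by (simp only: mult_ac)
    also have "card ?Y * (q + 1) = (\<Sum>i\<in>?Y. q + 1)" by simp
    also have "\<dots> \<le> (\<Sum>i\<in>?Y. card (f i))"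
      using H.card_on_secant e_sec by (intro sum_mono) (auto simp: f_def)
    also have "\<dots> \<le> (\<Sum>i\<in>X. card (f i))" using fX by (intro sum_mono2) auto
    also have "\<dots> = (\<Sum>P\<in>H.points. card (L.through X P))" by (rule L.sum_card_through[OF X(1), symmetric])
    finally show "q * card X \<le> 2 * (\<Sum>P\<in>H.points. card (L.through X P))" by simp
  qed
  then show ?thesis
    using L.simple_graph_edges L.K4_free_edges
    by (intro exI[of _ "{..<n}"] exI[of _ "L.edges w"]) (auto simp: n_def)
qed

end
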